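(* Let $\theta$ be a Blaschke product of order $3$, let $v_1, v_2, v_3$ be a $C_{\theta}$-real basis for $K_{\theta}$, let $t_1, t_2, t_3$ be distinct points on $\mathbb{T}$ and let $\lambda_4, \lambda_5$ be distinct points in $\mathbb{D}$. Let $$S = \begin{pmatrix} s_1 & s_4 & s_5 \\ s_4 & s_2 & s_6 \\ s_5 & s_6 & s_3 \end{pmatrix}$$ be a symmetric matrix with complex entries. Then there exists a truncated Toeplitz operator $A$ on $K_\theta$ whose matrix representation with respect to the basis $v_1,v_2,v_3$ is $S$ (i.e. $[A]_{v_j}=S$) if and only if $$\det [c_1 , c_2, c_3, c_4, c_5, \tilde{S}] =0,$$ where $[c_1,\dots,c_5,\tilde S]$ is the $6\times 6$ matrix with the columns $$c_i = \begin{pmatrix} v_1(t_i) \overline{v_1(t_i)} \\ v_2(t_i) \overline{v_2(t_i)} \\ v_3(t_i) \overline{v_3(t_i)} \\ v_1(t_i) \overline{v_2(t_i)} \\ v_1(t_i) \overline{v_3(t_i)} \\ v_2(t_i) \overline{v_3(t_i)} \end{pmatrix} \ (i=1,2,3), \qquad c_i = \begin{pmatrix} \overline{v_1(\lambda_i)v_1(\lambda_i)} \\ \overline{v_2(\lambda_i)v_2(\lambda_i)} \\ \overline{v_3(\lambda_i)v_3(\lambda_i)} \\ \overline{v_1(\lambda_i)v_2(\lambda_i)} \\ \overline{v_1(\lambda_i)v_3(\lambda_i)} \\ \overline{v_2(\lambda_i)v_3(\lambda_i)} \end{pmatrix}\ (i=4,5), \qquad \tilde{S} = \begin{pmatrix}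 s_1 \\ s_2 \\ s_3 \\ s_4 \\ s_5 \\ s_6 \end{pmatrix}.$$
   Context: $\mathbb{D}$ is the open unit disc in $\mathbb{C}$ and $\mathbb{T}$ the unit circle. $H^2$ is the Hardy space of the disc, viewed via radial boundary values as a closed subspace of $L^2(\mathbb{T})$ (normalized Lebesgue measure; inner product linear in the first variable). A finite Blaschke product $\theta$ has order $n$ if it has $n$ zeros in $\mathbb{D}$ counted with multiplicity. The model space is $K_\theta = H^2 \ominus \theta H^2$; for $\theta$ a finite Blaschke product of order $n$ it has dimension $n$ and every $f\in K_\theta$ has a well-defined value $f(\zeta)$ (nontangential limit) at every $\zeta\in\mathbb{T}$. The canonical conjugation on $K_\theta$ is the antilinear isometric involution $C_\theta f = \theta\,\overline{z f}$ (functions on $\mathbb{T}$). A $C_\theta$-real basis for $K_\theta$ is an orthonormal basis $v_1,\dots,v_n$ of $K_\theta$ with $C_\theta v_j = v_j$ for all $j$. A truncated Toeplitz operator (TTO) on $K_\theta$ is an operator of the form $A_\phi f = P_\theta(\phi f)$, $f \in K_\theta$, for some $\phi\in L^\infty(\mathbb{T})$, where $P_\theta: L^2(\mathbb{T})\to K_\theta$ is the orthogonal projection. For an operator $A$ on $K_\theta$, $[A]_{v_j}$ denotes the matrix of $A$ with respect to the basis $v_1,\dots,v_n$, with $(i,j)$ entry $\langle A v_j, v_i\rangle$. *)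

theory Defs
  imports "HOL-Analysis.Analysis"
begin

text \<open>
  Elements of \<open>L\<^sup>2(\<T>)\<close>, \<open>H\<^sup>2\<close> and the model spaces are represented by functions
  \<open>complex \<Rightarrow> complex\<close>, of which only the values on the unit circle, up to null sets, matter.
  The measure lives on the circle itself, so that nothing, not even measurability, depends on
  values off the circle. Equality of two such elements is stated almost everywhere
  with respect to \<open>circle_measure\<close>.
\<close>

definition circle_measure :: "complex measure" where
  "circle_measure =
     distr (uniform_measure lborel {0..2 * pi}) (restrict_space borel (sphere 0 1)) cis"

definition L2_circle :: "(complex \<Rightarrow> complex) set" where
  "L2_circle = {F \<in> borel_measurable circle_measure.
     integrable circle_measure (\<lambda>\<zeta>. (norm (F \<zeta>))\<^sup>2)}"

definition Linf_circle :: "(complex \<Rightarrow> complex) set" where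
  "Linf_circle = {\<phi> \<in> borel_measurable circle_measure.
     \<exists>M::real. AE \<zeta> in circle_measure. norm (\<phi> \<zeta>) \<le> M}"

definition L2_inner :: "(complex \<Rightarrow> complex) \<Rightarrow> (complex \<Rightarrow> complex) \<Rightarrow> complex" where
  "L2_inner F G = (LINT \<zeta>|circle_measure. F \<zeta> * cnj (G \<zeta>))"

definition hardy_disc :: "(complex \<Rightarrow> complex) set" where
  "hardy_disc = {f. f holomorphic_on ball 0 1 \<and>
     bdd_above ((\<lambda>r::real. LINT \<zeta>|circle_measure. (norm (f (of_real r * \<zeta>)))\<^sup>2) ` {0..<1})}"

definition radial_boundary :: "(complex \<Rightarrow> complex) \<Rightarrow> (complex \<Rightarrow> complex) \<Rightarrow> bool" where
  "radial_boundary f F \<longleftrightarrow>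
     (AE \<zeta> in circle_measure. ((\<lambda>r::real. f (of_real r * \<zeta>)) \<longlongrightarrow> F \<zeta>) (at_left 1))"

text \<open>The Hardy space as a subspace of \<open>L\<^sup>2(\<T>)\<close>: the radial boundary functions of \<open>hardy_disc\<close>.\<close>

definition H2 :: "(complex \<Rightarrow> complex) set" where
  "H2 = {F \<in> L2_circle. \<exists>f\<in>hardy_disc. radial_boundary f F}"

text \<open>
  For \<open>F \<in> H2\<close> the function \<open>f \<in> hardy_disc\<close> with boundary function \<open>F\<close> is unique on the open
  disc; its values elsewhere are arbitrary and never used.
\<close>

definition disc_extension :: "(complex \<Rightarrow> complex) \<Rightarrow> complex \<Rightarrow> complex" where
  "disc_extension F = (SOME f. f \<in> hardy_disc \<and> radial_boundary f F)"

definition stolz_region :: "real \<Rightarrow> complex \<Rightarrow> complex set" where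
  "stolz_region \<alpha> \<zeta> = {z \<in> ball 0 1. norm (z - \<zeta>) < \<alpha> * (1 - norm z)}"

definition nontangential_lim :: "(complex \<Rightarrow> complex) \<Rightarrow> complex \<Rightarrow> complex" where
  "nontangential_lim f \<zeta> = (THE L. \<forall>\<alpha>>1. (f \<longlongrightarrow> L) (at \<zeta> within stolz_region \<alpha> \<zeta>))"

text \<open>
  The value \<open>F(z)\<close> at an individual point of the closed disc. At a point of the circle it is the
  nontangential limit, not the value of the chosen representative \<open>F\<close>.
\<close>

definition point_value :: "(complex \<Rightarrow> complex) \<Rightarrow> complex \<Rightarrow> complex" where
  "point_value F z =
     (if norm z < 1 then disc_extension F z else nontangential_lim (disc_extension F) z)"

definition finite_blaschke :: "nat \<Rightarrow> (complex \<Rightarrow> complex) \<Rightarrow> bool" where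
  "finite_blaschke n \<theta> \<longleftrightarrow> (\<exists>c as. norm c = 1 \<and> length as = n \<and> set as \<subseteq> ball 0 1 \<and>
     (\<forall>z\<in>cball 0 1. \<theta> z = c * (\<Prod>a\<leftarrow>as. (z - a) / (1 - cnj a * z))))"

definition model_space :: "(complex \<Rightarrow> complex) \<Rightarrow> (complex \<Rightarrow> complex) set" where
  "model_space \<theta> = {F \<in> H2. \<forall>G\<in>H2. L2_inner F (\<lambda>\<zeta>. \<theta> \<zeta> * G \<zeta>) = 0}"

definition model_conj :: "(complex \<Rightarrow> complex) \<Rightarrow> (complex \<Rightarrow> complex) \<Rightarrow> complex \<Rightarrow> complex" where
  "model_conj \<theta> F = (\<lambda>\<zeta>. \<theta> \<zeta> * cnj (\<zeta> * F \<zeta>))"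

definition model_orthonormal_basis ::
  "(complex \<Rightarrow> complex) \<Rightarrow> ('n::finite \<Rightarrow> complex \<Rightarrow> complex) \<Rightarrow> bool" where
  "model_orthonormal_basis \<theta> v \<longleftrightarrow>
     (\<forall>j. v j \<in> model_space \<theta>) \<and>
     (\<forall>i j. L2_inner (v i) (v j) = (if i = j then 1 else 0)) \<and>
     (\<forall>F\<in>model_space \<theta>. \<exists>a. AE \<zeta> in circle_measure. F \<zeta> = (\<Sum>j\<in>UNIV. a j * v j \<zeta>))"

definition C_real_basis ::
  "(complex \<Rightarrow> complex) \<Rightarrow> ('n::finite \<Rightarrow> complex \<Rightarrow> complex) \<Rightarrow> bool" where
  "C_real_basis \<theta> v \<longleftrightarrow> model_orthonormal_basis \<theta> v \<and>
     (\<forall>j. AE \<zeta> in circle_measure. model_conj \<theta> (v j) \<zeta> = v j \<zeta>)"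

text \<open>The orthogonal projection onto the model space; the chosen function is unique up to null sets.\<close>

definition model_proj :: "(complex \<Rightarrow> complex) \<Rightarrow> (complex \<Rightarrow> complex) \<Rightarrow> complex \<Rightarrow> complex" where
  "model_proj \<theta> F =
     (SOME G. G \<in> model_space \<theta> \<and> (\<forall>H\<in>model_space \<theta>. L2_inner (\<lambda>\<zeta>. F \<zeta> - G \<zeta>) H = 0))"

definition truncated_toeplitz ::
  "(complex \<Rightarrow> complex) \<Rightarrow> ((complex \<Rightarrow> complex) \<Rightarrow> complex \<Rightarrow> complex) \<Rightarrow> bool" where
  "truncated_toeplitz \<theta> A \<longleftrightarrow> (\<exists>\<phi>\<in>Linf_circle. \<forall>F\<in>model_space \<theta>.
     A F \<in> model_space \<theta> \<and>
     (AE \<zeta> in circle_measure. A F \<zeta> = model_proj \<theta> (\<lambda>\<xi>. \<phi> \<xi> * F \<xi>) \<zeta>))"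

definition basis_matrix ::
  "('n::finite \<Rightarrow> complex \<Rightarrow> complex) \<Rightarrow> ((complex \<Rightarrow> complex) \<Rightarrow> complex \<Rightarrow> complex) \<Rightarrow>
   complex ^ 'n ^ 'n" where
  "basis_matrix v A = (\<chi> i j. L2_inner (A (v j)) (v i))"

definition circle_column :: "(3 \<Rightarrow> complex \<Rightarrow> complex) \<Rightarrow> complex \<Rightarrow> complex ^ 6" where
  "circle_column v t = (let w = (\<lambda>j. point_value (v j) t) in
     vector [w 1 * cnj (w 1), w 2 * cnj (w 2), w 3 * cnj (w 3),
             w 1 * cnj (w 2), w 1 * cnj (w 3), w 2 * cnj (w 3)])"

definition disc_column :: "(3 \<Rightarrow> complex \<Rightarrow> complex) \<Rightarrow> complex \<Rightarrow> complex ^ 6" where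
  "disc_column v l = (let w = (\<lambda>j. point_value (v j) l) in
     vector [cnj (w 1 * w 1), cnj (w 2 * w 2), cnj (w 3 * w 3),
             cnj (w 1 * w 2), cnj (w 1 * w 3), cnj (w 2 * w 3)])"

end

theory Submission
  imports Defs "HOL-Complex_Analysis.Complex_Analysis"
begin

text \<open>
On the circle, \<open>\<theta> = c \<zeta>\<^sup>3 cnj q / q\<close> where \<open>q\<close> is the denominator of \<open>\<theta>\<close>. The model space consists of the quotients \<open>p / q\<close> with
\<open>deg p \<le> 2\<close> (\<open>model_fun_model_space\<close>, \<open>model_space_imp_model_fun\<close>), so \<open>v\<^sub>j = p\<^sub>j / q\<close> for a basis \<open>p\<^sub>1, p\<^sub>2, p\<^sub>3\<close> of the quadratic
polynomials. Since \<open>v\<^sub>i = \<theta> cnj (\<zeta> v\<^sub>i)\<close>, the entry of \<open>A\<^sub>\<phi>\<close> at \<open>(i, j)\<close> is the integral of \<open>\<phi> cnj \<theta> \<zeta> p\<^sub>i p\<^sub>j / q\<^sup>2\<close>, that is,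
\<open>L (p\<^sub>i p\<^sub>j)\<close> for a linear functional \<open>L\<close> on the polynomials of degree at most \<open>4\<close>, and every functional \<open>L\<close> arises in this way
(\<open>truncated_toeplitz_matrix_iff\<close>).

The five columns have the same form. Because the \<open>p\<^sub>j\<close> are, up to the factor \<open>c\<close>, fixed under reflection in the circle, the
column of a point \<open>t\<close> of the circle is a nonzero multiple of evaluation of the products \<open>p\<^sub>i p\<^sub>j\<close> at \<open>t\<close>, and
that of a point \<open>\<lambda>\<close> of the disc is a nonzero multiple of evaluation at the reflected point \<open>1 / cnj \<lambda>\<close>, which is the point at infinity
for \<open>\<lambda> = 0\<close>. These are five distinct points of the projective line, so the evaluations form a basis of the
five-dimensional dual space. The products \<open>p\<^sub>i p\<^sub>j\<close> span the polynomials of degree at most \<open>4\<close>, hence the five columns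
are a basis of the space of all columns coming from functionals. The determinant vanishes exactly
when the sixth column lies in this space (\<open>det_hom_eval_rows_eq_0_iff\<close>).

The analytic input is the reproducing formula for Hardy functions in terms of their radial boundary values
(\<open>hardy_reproducing\<close>). It identifies the analytic extension and thereby the point values of model space functions, and
it yields the orthogonality relations. The form \<open>p / q\<close> of a model space function follows by dividing off the zeros of \<open>\<theta>\<close> one
at a time inside \<open>H\<^sup>2\<close> (\<open>H2_division\<close>).
\<close>

section \<open>Binary forms and the determinant criterion\<close>

lemma poly_eq_sum_le: "degree p \<le> m \<Longrightarrow> poly p z = (\<Sum>k\<le>m. coeff p k * z ^ k)"
  for p :: "complex poly"
  unfolding poly_altdef by (rule sum.mono_neutral_left) (auto simp: coeff_eq_0)

text \<open>
The value at \<open>(x, y)\<close> of the binary form of degree \<open>d\<close> with dehomogenization \<open>p\<close>. Homogeneous coordinates include the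
point at infinity, which is needed for the origin of the disc.
\<close>

definition hom_eval :: "nat \<Rightarrow> complex poly \<Rightarrow> complex \<Rightarrow> complex \<Rightarrow> complex" where
  "hom_eval d p x y = (\<Sum>k\<le>d. coeff p k * x ^ k * y ^ (d - k))"

lemma hom_eval_nonzero:
  assumes "y \<noteq> 0" "degree p \<le> d"
  shows "hom_eval d p x y = y ^ d * poly p (x / y)"
proof -
  have "poly p (x / y) = (\<Sum>k\<le>d. coeff p k * (x / y) ^ k)"
    using assms(2) by (rule poly_eq_sum_le)
  then show ?thesis
    unfolding hom_eval_def sum_distrib_left
    using assms(1) by (auto intro!: sum.cong simp: sum_distrib_left power_divide power_diff)
qed

lemma hom_eval_zero: "hom_eval d p x 0 = coeff p d * x ^ d"
proof -
  have "hom_eval d p x 0 = (\<Sum>k\<le>d. if k = d then coeff p d * x ^ d else 0)"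
    unfolding hom_eval_def by (rule sum.cong) auto
  then show ?thesis by simp
qed

lemma hom_eval_mult:
  assumes "degree p \<le> d" "degree q \<le> e"
  shows "hom_eval (d + e) (p * q) x y = hom_eval d p x y * hom_eval e q x y"
proof (cases "y = 0")
  case True
  have "coeff (p * q) (d + e) = coeff p d * coeff q e"
  proof (cases "degree p = d \<and> degree q = e")
    case True
    then show ?thesis using coeff_mult_degree_sum[of p q] by simp
  next
    case False
    then have "degree p + degree q < d + e" using assms by linarith
    then have "degree (p * q) < d + e" using degree_mult_le[of p q] by linarith
    moreover have "coeff p d * coeff q e = 0"
      using False assms by (metis coeff_eq_0 le_neq_implies_less mult_zero_left mult_zero_right)
    ultimately show ?thesis by (simp add: coeff_eq_0)
  qed
  then show ?thesis using True by (simp add: hom_eval_zero power_add)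
next
  case False
  have "degree (p * q) \<le> d + e" using assms degree_mult_le[of p q] by linarith
  then show ?thesis using False assms by (simp add: hom_eval_nonzero power_add)
qed

lemma hom_eval_linear: "hom_eval 1 [:- a, b:] x y = x * b - y * a"
  by (simp add: hom_eval_def)

lemma hom_eval_prod_linear:
  assumes "finite J"
  shows "degree (\<Prod>j\<in>J. [:- a j, b j:]) \<le> card J"
    and "hom_eval (card J) (\<Prod>j\<in>J. [:- a j, b j:]) x y = (\<Prod>j\<in>J. x * b j - y * a j)"
proof -
  have "degree (\<Prod>j\<in>J. [:- a j, b j:]) \<le> card J \<and>
    hom_eval (card J) (\<Prod>j\<in>J. [:- a j, b j:]) x y = (\<Prod>j\<in>J. x * b j - y * a j)"
    using assms
  proof (induction J)
    case empty
    then show ?case by (simp add: hom_eval_def)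
  next
    case (insert j J)
    let ?P = "\<Prod>j\<in>J. [:- a j, b j:]"
    have lin: "degree [:- a j, b j:] \<le> 1" by simp
    have "degree ([:- a j, b j:] * ?P) \<le> 1 + card J"
      using degree_mult_le[of "[:- a j, b j:]" ?P] insert.IH lin by linarith
    moreover have "hom_eval (1 + card J) ([:- a j, b j:] * ?P) x y =
        (x * b j - y * a j) * (\<Prod>j\<in>J. x * b j - y * a j)"
      using insert.IH by (subst hom_eval_mult[OF lin]) (auto simp: hom_eval_linear simp del: One_nat_def)
    ultimately show ?case using insert.hyps by simp
  qed
  then show "degree (\<Prod>j\<in>J. [:- a j, b j:]) \<le> card J"
    and "hom_eval (card J) (\<Prod>j\<in>J. [:- a j, b j:]) x y = (\<Prod>j\<in>J. x * b j - y * a j)"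
    by auto
qed

text \<open>
The Lagrange form, the product of the linear forms vanishing at all points but the \<open>i\<close>-th, isolates the coefficient \<open>u i\<close>. So evaluations
at \<open>d + 1\<close> distinct points of the projective line are linearly independent on forms of degree \<open>d\<close>.
\<close>

lemma hom_eval_independent:
  assumes J: "finite J" "card J = Suc d"
    and distinct: "\<And>i j. i \<in> J \<Longrightarrow> j \<in> J \<Longrightarrow> i \<noteq> j \<Longrightarrow> x i * y j \<noteq> y i * x j"
    and zero: "\<And>r. degree r \<le> d \<Longrightarrow> (\<Sum>i\<in>J. u i * hom_eval d r (x i) (y i)) = 0"
    and i: "i \<in> J"
  shows "u i = 0"
proof -
  let ?r = "\<Prod>j\<in>J - {i}. [:- x j, y j:]"
  have card: "card (J - {i}) = d" using J i by simp
  have fin: "finite (J - {i})" using J by simp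
  have deg: "degree ?r \<le> d" using hom_eval_prod_linear(1)[OF fin, of x y] card by simp
  have ev: "hom_eval d ?r a b = (\<Prod>j\<in>J - {i}. a * y j - b * x j)" for a b
    using hom_eval_prod_linear(2)[OF fin, of x y] card by simp
  have "0 = (\<Sum>k\<in>J. u k * hom_eval d ?r (x k) (y k))" using zero[OF deg] by simp
  also have "\<dots> = (\<Sum>k\<in>J. if k = i then u i * hom_eval d ?r (x i) (y i) else 0)"
  proof (rule sum.cong)
    fix k assume k: "k \<in> J"
    have "(\<Prod>j\<in>J - {i}. x k * y j - y k * x j) = 0" if "k \<noteq> i"
      using fin k that by (subst prod_zero_iff) (auto intro!: bexI[of _ k])
    then show "u k * hom_eval d ?r (x k) (y k) = (if k = i then u i * hom_eval d ?r (x i) (y i) else 0)"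
      by (auto simp: ev)
  qed simp
  also have "\<dots> = u i * (\<Prod>j\<in>J - {i}. x i * y j - y i * x j)" using J i by (simp add: ev)
  finally have "u i * (\<Prod>j\<in>J - {i}. x i * y j - y i * x j) = 0" by simp
  moreover have "(\<Prod>j\<in>J - {i}. x i * y j - y i * x j) \<noteq> 0"
    using fin distinct i by (subst prod_zero_iff) auto
  ultimately show ?thesis by simp
qed

lemma det_eq_0_iff_row_relation:
  fixes A :: "complex ^ 'n ^ 'n"
  shows "det A = 0 \<longleftrightarrow> (\<exists>u. (\<exists>i. u i \<noteq> 0) \<and> (\<forall>a. (\<Sum>i\<in>UNIV. u i * A $ i $ a) = 0))"
proof -
  have "det A \<noteq> 0 \<longleftrightarrow> (\<exists>B. A ** B = mat 1)"
    by (metis invertible_det_nz invertible_right_inverse)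
  also have "\<dots> \<longleftrightarrow> (\<forall>u. (\<Sum>i\<in>UNIV. u i *s row i A) = 0 \<longrightarrow> (\<forall>i. u i = 0))"
    by (rule matrix_right_invertible_independent_rows)
  also have "\<dots> \<longleftrightarrow> (\<forall>u. (\<forall>a. (\<Sum>i\<in>UNIV. u i * A $ i $ a) = 0) \<longrightarrow> (\<forall>i. u i = 0))"
    by (simp add: vec_eq_iff row_def)
  finally show ?thesis by blast
qed

lemma det_eq_0_iff_column_relation:
  fixes A :: "complex ^ 'n ^ 'n"
  shows "det A = 0 \<longleftrightarrow> (\<exists>u. (\<exists>a. u a \<noteq> 0) \<and> (\<forall>i. (\<Sum>a\<in>UNIV. A $ i $ a * u a) = 0))"
  using det_eq_0_iff_row_relation[of "transpose A"]
  by (simp add: det_transpose) (simp add: transpose_def mult.commute)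

text \<open>
Let \<open>e\<close> be a family of \<open>d + 2\<close> polynomials that separates the linear functionals on the \<open>d + 1\<close>-dimensional space of polynomials of degree
at most \<open>d\<close>. Applying functionals to the family embeds the dual space as a hyperplane in the space of rows. The rows other
than the \<open>k\<close>-th come from \<open>d + 1\<close> independent functionals and span this hyperplane. So the determinant vanishes iff
the \<open>k\<close>-th row lies in the hyperplane, that is, comes from a functional \<open>l\<close> as well.
\<close>

lemma det_hom_eval_rows_eq_0_iff:
  fixes e :: "'n::finite \<Rightarrow> complex poly" and k :: 'n and M :: "complex ^ 'n ^ 'n"
  assumes card: "CARD('n) = d + 2"
    and deg: "\<And>a. degree (e a) \<le> d"
    and total: "\<And>l r. (\<And>a. (\<Sum>j\<le>d. coeff (e a) j * l j) = 0) \<Longrightarrow> degree r \<le> d \<Longrightarrow> (\<Sum>j\<le>d. coeff r j * l j) = 0"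
    and distinct: "\<And>i j. i \<noteq> k \<Longrightarrow> j \<noteq> k \<Longrightarrow> i \<noteq> j \<Longrightarrow> x i * y j \<noteq> y i * x j"
    and rows: "\<And>i a. i \<noteq> k \<Longrightarrow> M $ i $ a = \<kappa> i * hom_eval d (e a) (x i) (y i)"
    and \<kappa>: "\<And>i. i \<noteq> k \<Longrightarrow> \<kappa> i \<noteq> 0"
  shows "det M = 0 \<longleftrightarrow> (\<exists>l. \<forall>a. M $ k $ a = (\<Sum>j\<le>d. coeff (e a) j * l j))"
proof
  define h where "h = (\<lambda>i j. x i ^ j * y i ^ (d - j))"
  have hom: "hom_eval d r (x i) (y i) = (\<Sum>j\<le>d. coeff r j * h i j)" for r i
    by (simp add: hom_eval_def h_def mult.assoc)
  have cardk: "card (UNIV - {k}) = Suc d" using card by simp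
  {
    assume "det M = 0"
    then obtain u where u: "\<exists>i. u i \<noteq> 0" and rel: "\<And>a. (\<Sum>i\<in>UNIV. u i * M $ i $ a) = 0"
      by (auto simp: det_eq_0_iff_row_relation)
    define l where "l = (\<lambda>j. \<Sum>i\<in>UNIV - {k}. u i * \<kappa> i * h i j)"
    have l: "(\<Sum>j\<le>d. coeff r j * l j) = (\<Sum>i\<in>UNIV - {k}. u i * \<kappa> i * hom_eval d r (x i) (y i))" for r
      unfolding l_def hom sum_distrib_left by (subst sum.swap) (simp add: mult_ac)
    have rel': "u k * M $ k $ a + (\<Sum>j\<le>d. coeff (e a) j * l j) = 0" for a
    proof -
      have "(\<Sum>i\<in>UNIV. u i * M $ i $ a) = u k * M $ k $ a + (\<Sum>i\<in>UNIV - {k}. u i * M $ i $ a)"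
        by (rule sum.remove) auto
      also have "(\<Sum>i\<in>UNIV - {k}. u i * M $ i $ a) = (\<Sum>j\<le>d. coeff (e a) j * l j)"
        unfolding l by (rule sum.cong) (auto simp: rows mult.assoc)
      finally show ?thesis using rel by simp
    qed
    \<comment> \<open>Otherwise the relation would be one among the evaluation functionals alone.\<close>
    have "u k \<noteq> 0"
    proof
      assume uk: "u k = 0"
      have "(\<Sum>i\<in>UNIV - {k}. (u i * \<kappa> i) * hom_eval d r (x i) (y i)) = 0" if "degree r \<le> d" for r
        using total[of l r] rel' uk that l by simp
      then have "u i * \<kappa> i = 0" if "i \<noteq> k" for i
        using hom_eval_independent[of "UNIV - {k}" d x y "\<lambda>i. u i * \<kappa> i" i] cardk distinct that by auto
      then show False using u uk \<kappa> by (metis mult_eq_0_iff)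
    qed
    then have "M $ k $ a = (\<Sum>j\<le>d. coeff (e a) j * (- l j / u k))" for a
      using rel'[of a] by (simp add: sum_divide_distrib[symmetric] sum_negf field_simps eq_neg_iff_add_eq_0)
    then show "\<exists>l. \<forall>a. M $ k $ a = (\<Sum>j\<le>d. coeff (e a) j * l j)"
      by (intro exI[of _ "\<lambda>j. - l j / u k"]) simp
  }
  {
    assume "\<exists>l. \<forall>a. M $ k $ a = (\<Sum>j\<le>d. coeff (e a) j * l j)"
    then obtain l where l: "\<And>a. M $ k $ a = (\<Sum>j\<le>d. coeff (e a) j * l j)" by blast
    obtain b where b: "bij_betw b (UNIV - {k}) {..d}"
      using finite_same_card_bij[of "UNIV - {k}" "{..d}"] cardk by auto
    \<comment> \<open>A linear relation among the \<open>e a\<close> is in the kernel of their coefficient matrix, filled up to a square by a zero row.\<close>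
    define N :: "complex ^ 'n ^ 'n" where "N = (\<chi> i a. if i = k then 0 else coeff (e a) (b i))"
    have "det N = 0"
      unfolding det_eq_0_iff_row_relation
      by (intro exI[of _ "\<lambda>i. if i = k then 1 else 0"]) (auto simp: N_def intro!: sum.neutral)
    then obtain u where u: "\<exists>a. u a \<noteq> 0" and rel: "\<And>i. (\<Sum>a\<in>UNIV. N $ i $ a * u a) = 0"
      by (auto simp: det_eq_0_iff_column_relation)
    have coeffs: "(\<Sum>a\<in>UNIV. coeff (e a) j * u a) = 0" if "j \<le> d" for j
    proof -
      have "j \<in> b ` (UNIV - {k})" using that b by (simp add: bij_betw_def)
      then obtain i where "i \<noteq> k" "b i = j" by auto
      with rel[of i] show ?thesis by (simp add: N_def)
    qed
    have functional: "(\<Sum>a\<in>UNIV. (\<Sum>j\<le>d. coeff (e a) j * f j) * u a) = 0" for f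
    proof -
      have "(\<Sum>a\<in>UNIV. (\<Sum>j\<le>d. coeff (e a) j * f j) * u a) =
          (\<Sum>j\<le>d. f j * (\<Sum>a\<in>UNIV. coeff (e a) j * u a))"
        unfolding sum_distrib_left sum_distrib_right by (subst sum.swap) (simp add: mult_ac)
      then show ?thesis using coeffs by simp
    qed
    have "(\<Sum>a\<in>UNIV. M $ i $ a * u a) = 0" for i
    proof (cases "i = k")
      case True
      then show ?thesis using functional[of l] by (simp add: l)
    next
      case False
      have "(\<Sum>a\<in>UNIV. M $ i $ a * u a) = \<kappa> i * (\<Sum>a\<in>UNIV. (\<Sum>j\<le>d. coeff (e a) j * h i j) * u a)"
        by (subst sum_distrib_left) (simp add: rows[OF False] hom mult.assoc)
      then show ?thesis using functional[of "h i"] by simp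
    qed
    with u show "det M = 0" unfolding det_eq_0_iff_column_relation by blast
  }
qed

section \<open>Integration and square integrable functions on the circle\<close>

lemma sets_circle_measure [measurable_cong]:
  "sets circle_measure = sets (restrict_space borel (sphere 0 1))"
  by (simp add: circle_measure_def)

lemma space_circle_measure: "space circle_measure = sphere 0 1"
  by (simp add: circle_measure_def)

lemma continuous_on_imp_measurable_circle:
  "continuous_on (sphere 0 1) f \<Longrightarrow> f \<in> borel_measurable circle_measure"
  using borel_measurable_continuous_on_restrict measurable_cong_sets sets_circle_measure by blast

lemma measurable_cis:
  "cis \<in> measurable (uniform_measure lborel {0..2*pi}) (restrict_space borel (sphere 0 1))"
proof -
  have "cis \<in> borel_measurable (uniform_measure lborel {0..2*pi})"
    using borel_measurable_continuous_onI[OF continuous_on_cis[OF continuous_on_id]]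
    by (simp add: measurable_cong_sets[OF sets_uniform_measure refl] eta_contract_eq)
  then show ?thesis
    by (intro measurable_restrict_space2) auto
qed

interpretation circle: finite_measure circle_measure
proof
  have "emeasure circle_measure (space circle_measure) =
      emeasure (uniform_measure lborel {0..2*pi}) (cis -` sphere 0 1 \<inter> UNIV)"
    unfolding space_circle_measure unfolding circle_measure_def
    by (subst emeasure_distr[OF measurable_cis]) (auto simp: sets_restrict_space image_iff)
  also have "cis -` sphere 0 1 \<inter> UNIV = UNIV" by auto
  also have "emeasure (uniform_measure lborel {0..2*pi}) UNIV = 1"
    by (subst emeasure_uniform_measure) (auto simp: divide_ennreal)
  finally have "emeasure circle_measure (space circle_measure) = 1" .
  then show "emeasure circle_measure (space circle_measure) \<noteq> \<infinity>" by simp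
qed

lemma integral_circle_measure:
  fixes f :: "complex \<Rightarrow> complex"
  assumes "continuous_on (sphere 0 1) f"
  shows "(LINT \<zeta>|circle_measure. f \<zeta>) = integral {0..2*pi} (\<lambda>x. f (cis x)) / (2*pi)"
proof -
  have cont: "continuous_on A (\<lambda>x. f (cis x))" for A
    by (rule continuous_on_compose2[OF assms]) (auto intro!: continuous_intros)
  have meas: "(\<lambda>x. f (cis x)) \<in> borel_measurable lborel"
    using borel_measurable_continuous_onI[OF cont] by simp
  have "(LINT \<zeta>|circle_measure. f \<zeta>) = (LINT x|uniform_measure lborel {0..2*pi}. f (cis x))"
    unfolding circle_measure_def
    by (rule integral_distr[OF measurable_cis])
       (rule borel_measurable_continuous_on_restrict[OF assms])
  also have "uniform_measure lborel {0..2*pi} =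
      density lborel (\<lambda>x. ennreal (indicator {0..2*pi} x / (2*pi)))"
    unfolding uniform_measure_def
    by (rule arg_cong[where f = "density lborel"])
       (auto simp: fun_eq_iff indicator_def divide_ennreal[symmetric])
  also have "(LINT x|density lborel (\<lambda>x. ennreal (indicator {0..2*pi} x / (2*pi))). f (cis x)) =
      (LINT x|lborel. (indicator {0..2*pi} x / (2*pi)) *\<^sub>R f (cis x))"
    by (rule integral_density) (use meas in auto)
  also have "\<dots> = (LINT x|lborel. (1/(2*pi)) *\<^sub>R (indicator {0..2*pi} x *\<^sub>R f (cis x)))"
    by simp
  also have "\<dots> = (1/(2*pi)) *\<^sub>R (LINT x:{0..2*pi}|lborel. f (cis x))"
    unfolding set_lebesgue_integral_def by (rule integral_scaleR_right) 
  also have "(LINT x:{0..2*pi}|lborel. f (cis x)) = integral {0..2*pi} (\<lambda>x. f (cis x))"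
    by (rule set_borel_integral_eq_integral(2)) (rule borel_integrable_atLeastAtMost', rule cont)
  finally show ?thesis by (simp add: scaleR_conv_of_real)
qed

lemma Cauchy_formula_circle_measure:
  assumes f: "f holomorphic_on ball 0 1" and r: "0 < r" "r < 1" and w: "norm w < r"
  shows "(LINT \<zeta>|circle_measure. f (of_real r * \<zeta>) * (of_real r * \<zeta> / (of_real r * \<zeta> - w))) = f w"
proof -
  have contf: "continuous_on (cball 0 r) f"
    using r by (intro holomorphic_on_imp_continuous_on holomorphic_on_subset[OF f]) auto
  have ne: "of_real r * \<zeta> - w \<noteq> 0" if "norm \<zeta> = 1" for \<zeta>
    using that w r by (auto simp: norm_mult)
  have cont: "continuous_on (sphere 0 1) (\<lambda>\<zeta>. f (of_real r * \<zeta>) * (of_real r * \<zeta> / (of_real r * \<zeta> - w)))"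
    using ne r by (intro continuous_intros continuous_on_compose2[OF contf]) (auto simp: norm_mult)
  have "((\<lambda>u. f u / (u - w)) has_contour_integral (2 * of_real pi * \<i> * f w)) (circlepath 0 r)"
    by (rule Cauchy_integral_circlepath_simple)
       (use w r in \<open>auto intro!: holomorphic_on_subset[OF f]\<close>)
  then have "((\<lambda>t. f (of_real r * cis t) / (of_real r * cis t - w) * of_real r * \<i> * cis t)
      has_integral (2 * of_real pi * \<i> * f w)) {0..2*pi}"
    unfolding circlepath_def by (subst (asm) has_contour_integral_part_circlepath_iff) auto
  then have "((\<lambda>t. f (of_real r * cis t) / (of_real r * cis t - w) * of_real r * \<i> * cis t / \<i>)
      has_integral (2 * of_real pi * \<i> * f w / \<i>)) {0..2*pi}"
    by (rule has_integral_divide)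
  then have "((\<lambda>t. f (of_real r * cis t) * (of_real r * cis t / (of_real r * cis t - w)))
      has_integral (2 * of_real pi * f w)) {0..2*pi}"
    by (rule has_integral_eq_rhs[OF has_integral_eq, rotated]) (simp_all add: field_simps)
  then show ?thesis
    unfolding integral_circle_measure[OF cont] by (subst integral_unique) auto
qed

lemma norm_add_squared_le: "(norm (x + y))\<^sup>2 \<le> 2 * (norm x)\<^sup>2 + 2 * (norm y)\<^sup>2"
  for x y :: "'a::real_normed_vector"
proof -
  have "(norm (x + y))\<^sup>2 \<le> (norm x + norm y)\<^sup>2"
    by (intro power_mono norm_triangle_ineq) auto
  also have "\<dots> \<le> 2 * (norm x)\<^sup>2 + 2 * (norm y)\<^sup>2"
    using zero_le_power2[of "norm x - norm y"] by (simp add: power2_eq_square algebra_simps)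
  finally show ?thesis .
qed

text \<open>
An \<open>L\<^sup>2\<close> bound makes the sequence uniformly integrable. Concretely, \<open>h \<le> min h K + h\<^sup>2 / K\<close> holds for all
\<open>h \<ge> 0\<close>: with \<open>h = \<bar>g\<^sub>k - G\<bar>\<close>, the integral of the first term tends to \<open>0\<close> by dominated convergence and
that of the second is small, uniformly in \<open>k\<close>, once \<open>K\<close> is large.
\<close>

lemma (in finite_measure) L2_bounded_AE_tendsto_imp_integral_tendsto:
  fixes g :: "nat \<Rightarrow> 'a \<Rightarrow> complex"
  assumes meas [measurable]: "\<And>k. g k \<in> borel_measurable M" "G \<in> borel_measurable M"
    and int: "\<And>k. integrable M (\<lambda>x. (norm (g k x))\<^sup>2)" "integrable M (\<lambda>x. (norm (G x))\<^sup>2)"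
    and bound: "\<And>k. (LINT x|M. (norm (g k x))\<^sup>2) \<le> B"
    and lim: "AE x in M. (\<lambda>k. g k x) \<longlonglongrightarrow> G x"
  shows "(\<lambda>k. LINT x|M. g k x) \<longlonglongrightarrow> (LINT x|M. G x)"
proof -
  define h where "h = (\<lambda>k x. norm (g k x - G x))"
  have [measurable]: "h k \<in> borel_measurable M" for k unfolding h_def by measurable
  have sq: "x \<le> 1 + x\<^sup>2" for x :: real
    using zero_le_power2[of "x - 1"] by (cases "x \<ge> 0") (auto simp: power2_eq_square algebra_simps intro: order_trans[OF _ add_nonneg_nonneg])
  have hsq: "(h k x)\<^sup>2 \<le> 2 * (norm (g k x))\<^sup>2 + 2 * (norm (G x))\<^sup>2" for k x
    using norm_add_squared_le[of "g k x" "- G x"] by (simp add: h_def)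
  have L1: "integrable M f" if [measurable]: "f \<in> borel_measurable M" and "integrable M (\<lambda>x. (norm (f x))\<^sup>2)"
    for f :: "'a \<Rightarrow> complex"
    by (rule Bochner_Integration.integrable_bound[of M "\<lambda>x. 1 + (norm (f x))\<^sup>2"])
       (use that sq in auto)
  have inth2: "integrable M (\<lambda>x. (h k x)\<^sup>2)" for k
    by (rule Bochner_Integration.integrable_bound[of M "\<lambda>x. 2 * (norm (g k x))\<^sup>2 + 2 * (norm (G x))\<^sup>2"])
       (use int hsq in auto)
  have inth: "integrable M (h k)" for k
    unfolding h_def by (intro integrable_norm Bochner_Integration.integrable_diff L1 int meas)
  define C where "C = 2 * B + 2 * (LINT x|M. (norm (G x))\<^sup>2)"
  have "0 \<le> (LINT x|M. (norm (g 0 x))\<^sup>2)" by simp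
  then have "0 \<le> B" using bound[of 0] by linarith
  then have C: "0 \<le> C" unfolding C_def by simp
  have hC: "(LINT x|M. (h k x)\<^sup>2) \<le> C" for k
  proof -
    have "(LINT x|M. (h k x)\<^sup>2) \<le> (LINT x|M. 2 * (norm (g k x))\<^sup>2 + 2 * (norm (G x))\<^sup>2)"
      by (intro integral_mono inth2 hsq) (use int in auto)
    also have "\<dots> = 2 * (LINT x|M. (norm (g k x))\<^sup>2) + 2 * (LINT x|M. (norm (G x))\<^sup>2)"
      using int by simp
    also have "\<dots> \<le> C" using bound[of k] unfolding C_def by simp
    finally show ?thesis .
  qed
  have dom: "(\<lambda>k. LINT x|M. min (h k x) K) \<longlonglongrightarrow> (LINT x|M. 0)" if "K > 0" for K
  proof (rule integral_dominated_convergence[where w = "\<lambda>_. K"])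
    show "AE x in M. (\<lambda>k. min (h k x) K) \<longlonglongrightarrow> 0"
      using lim
    proof eventually_elim
      case (elim x)
      then have "(\<lambda>k. h k x) \<longlonglongrightarrow> 0"
        unfolding h_def by (simp add: tendsto_norm_zero_iff LIM_zero_iff)
      then have "(\<lambda>k. min (h k x) K) \<longlonglongrightarrow> min 0 K" by (intro tendsto_intros)
      with that show ?case by simp
    qed
  qed (use that in \<open>auto simp: h_def\<close>)
  have h0: "(\<lambda>k. LINT x|M. h k x) \<longlonglongrightarrow> 0"
  proof (rule LIMSEQ_I)
    fix e :: real assume e: "e > 0"
    define K where "K = 2 * C / e + 1"
    have K: "K > 0" "C / K < e / 2"
      using C e unfolding K_def by (auto simp: add_nonneg_pos field_simps)
    from LIMSEQ_D[OF dom[OF K(1)], of "e/2"] e obtain N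
      where N: "\<And>k. k \<ge> N \<Longrightarrow> \<bar>LINT x|M. min (h k x) K\<bar> < e / 2" by auto
    have "norm ((LINT x|M. h k x) - 0) < e" if "k \<ge> N" for k
    proof -
      have le: "h k x \<le> min (h k x) K + (h k x)\<^sup>2 / K" for x
      proof (cases "h k x \<le> K")
        case False
        then have "h k x * K \<le> h k x * h k x" by (intro mult_left_mono) (auto simp: h_def)
        then have "h k x \<le> (h k x)\<^sup>2 / K" using K by (simp add: power2_eq_square field_simps)
        then show ?thesis using False K by (simp add: min_def)
      qed (use K in \<open>auto simp: h_def\<close>)
      have intmin: "integrable M (\<lambda>x. min (h k x) K)"
        by (rule Bochner_Integration.integrable_bound[OF inth[of k]]) (use K in \<open>auto simp: h_def\<close>)
      have "(LINT x|M. h k x) \<le> (LINT x|M. min (h k x) K + (h k x)\<^sup>2 / K)"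
        by (intro integral_mono inth le) (use intmin inth2 in auto)
      also have "\<dots> = (LINT x|M. min (h k x) K) + (LINT x|M. (h k x)\<^sup>2) / K"
        using intmin inth2 by simp
      also have "\<dots> < e / 2 + e / 2"
        using N[OF that] hC[of k] K by (smt (verit) divide_right_mono)
      finally show ?thesis by (simp add: h_def)
    qed
    then show "\<exists>no. \<forall>n\<ge>no. norm ((LINT x|M. h n x) - 0) < e" by blast
  qed
  have le: "norm ((LINT x|M. g k x) - (LINT x|M. G x)) \<le> (LINT x|M. h k x)" for k
  proof -
    have "(LINT x|M. g k x) - (LINT x|M. G x) = (LINT x|M. g k x - G x)"
      by (rule Bochner_Integration.integral_diff[symmetric]) (intro L1 meas int)+
    then show ?thesis unfolding h_def by (metis integral_norm_bound)
  qed
  have "(\<lambda>k. (LINT x|M. g k x) - (LINT x|M. G x)) \<longlonglongrightarrow> 0"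
    by (rule Lim_null_comparison[OF _ h0]) (use le in simp)
  then show ?thesis by (simp add: LIM_zero_iff)
qed

lemma continuous_on_circle_bounded:
  fixes f :: "complex \<Rightarrow> 'b::euclidean_space"
  assumes "continuous_on (sphere 0 1) f"
  obtains K where "\<And>\<zeta>. norm \<zeta> = 1 \<Longrightarrow> norm (f \<zeta>) \<le> K"
proof -
  have "bounded (f ` sphere 0 1)"
    by (intro compact_imp_bounded compact_continuous_image assms) auto
  then show ?thesis using that unfolding bounded_iff by (metis imageI mem_sphere_0)
qed

lemma integrable_circle_continuous:
  fixes f :: "complex \<Rightarrow> 'b::euclidean_space"
  assumes "continuous_on (sphere 0 1) f"
  shows "integrable circle_measure f"
proof -
  obtain K where "\<And>\<zeta>. norm \<zeta> = 1 \<Longrightarrow> norm (f \<zeta>) \<le> K"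
    using continuous_on_circle_bounded[OF assms] by blast
  then show ?thesis
    by (intro circle.integrable_const_bound[of _ K] continuous_on_imp_measurable_circle assms)
       (auto simp: space_circle_measure)
qed

lemma AE_circleI: "(\<And>\<zeta>. norm \<zeta> = 1 \<Longrightarrow> P \<zeta>) \<Longrightarrow> AE \<zeta> in circle_measure. P \<zeta>"
  by (rule AE_I2) (simp add: space_circle_measure)

lemma L2_circle_measurable [measurable_dest]: "F \<in> L2_circle \<Longrightarrow> F \<in> borel_measurable circle_measure"
  by (simp add: L2_circle_def)

lemma L2_circle_bounded:
  assumes "F \<in> L2_circle" "G \<in> borel_measurable circle_measure" 
    and "AE \<zeta> in circle_measure. norm (G \<zeta>) \<le> K * norm (F \<zeta>)"
  shows "G \<in> L2_circle"
proof -
  have [measurable]: "F \<in> borel_measurable circle_measure" "G \<in> borel_measurable circle_measure"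
    using assms by (auto simp: L2_circle_def)
  have "integrable circle_measure (\<lambda>\<zeta>. (norm (G \<zeta>))\<^sup>2)"
  proof (rule Bochner_Integration.integrable_bound)
    show "integrable circle_measure (\<lambda>\<zeta>. K\<^sup>2 * (norm (F \<zeta>))\<^sup>2)"
      using assms by (simp add: L2_circle_def)
    show "AE \<zeta> in circle_measure. norm ((norm (G \<zeta>))\<^sup>2) \<le> norm (K\<^sup>2 * (norm (F \<zeta>))\<^sup>2)"
      using assms(3) by eventually_elim (auto simp: power_mono simp flip: power_mult_distrib)
  qed measurable
  then show ?thesis by (simp add: L2_circle_def)
qed

lemma L2_circle_mult_bounded:
  assumes "F \<in> L2_circle" "b \<in> borel_measurable circle_measure" 
    and "AE \<zeta> in circle_measure. norm (b \<zeta>) \<le> K"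
  shows "(\<lambda>\<zeta>. b \<zeta> * F \<zeta>) \<in> L2_circle"
proof (rule L2_circle_bounded[OF assms(1)])
  show "AE \<zeta> in circle_measure. norm (b \<zeta> * F \<zeta>) \<le> K * norm (F \<zeta>)"
    using assms(3) by eventually_elim (simp add: norm_mult mult_right_mono)
qed (use assms in measurable)

lemma L2_circle_mult_continuous:
  assumes "F \<in> L2_circle" "continuous_on (sphere 0 1) b"
  shows "(\<lambda>\<zeta>. b \<zeta> * F \<zeta>) \<in> L2_circle"
proof -
  obtain K where "\<And>\<zeta>. norm \<zeta> = 1 \<Longrightarrow> norm (b \<zeta>) \<le> K"
    using continuous_on_circle_bounded[OF assms(2)] by blast
  then show ?thesis
    by (intro L2_circle_mult_bounded[of _ _ K] continuous_on_imp_measurable_circle assms AE_circleI) auto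
qed

lemma L2_circle_add:
  assumes "F \<in> L2_circle" "G \<in> L2_circle"
  shows "(\<lambda>\<zeta>. F \<zeta> + G \<zeta>) \<in> L2_circle"
proof -
  note [measurable] = assms[THEN L2_circle_measurable]
  have "integrable circle_measure (\<lambda>\<zeta>. (norm (F \<zeta> + G \<zeta>))\<^sup>2)"
    by (rule Bochner_Integration.integrable_bound
        [of _ "\<lambda>\<zeta>. 2 * (norm (F \<zeta>))\<^sup>2 + 2 * (norm (G \<zeta>))\<^sup>2"])
      (use assms norm_add_squared_le in \<open>auto simp: L2_circle_def\<close>)
  then show ?thesis by (simp add: L2_circle_def)
qed

lemma L2_circle_const: "(\<lambda>_. c) \<in> L2_circle"
  by (simp add: L2_circle_def)

lemma integrable_L2_mult:
  assumes "F \<in> L2_circle" "G \<in> L2_circle"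
  shows "integrable circle_measure (\<lambda>\<zeta>. F \<zeta> * cnj (G \<zeta>))"
proof -
  note [measurable] = assms[THEN L2_circle_measurable]
  have "norm x * norm y \<le> (norm x)\<^sup>2 + (norm y)\<^sup>2" for x y :: complex
  proof -
    have "0 \<le> norm x * norm y" by simp
    moreover have "2 * (norm x * norm y) \<le> (norm x)\<^sup>2 + (norm y)\<^sup>2"
      using sum_squares_bound[of "norm x" "norm y"] by (simp add: mult.assoc)
    ultimately show ?thesis by linarith
  qed
  note le = this
  have [measurable]: "(\<lambda>\<zeta>. cnj (G \<zeta>)) \<in> borel_measurable circle_measure"
    by (rule borel_measurable_continuous_on[of cnj]) (auto intro: continuous_intros)
  show ?thesis
    by (rule Bochner_Integration.integrable_bound
        [of _ "\<lambda>\<zeta>. (norm (F \<zeta>))\<^sup>2 + (norm (G \<zeta>))\<^sup>2"])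
      (use assms le in \<open>auto simp: L2_circle_def norm_mult\<close>)
qed

lemma integrable_L2: "F \<in> L2_circle \<Longrightarrow> integrable circle_measure F"
  using integrable_L2_mult[OF _ L2_circle_const[of 1]] by simp

lemma L2_inner_add_left:
  "F \<in> L2_circle \<Longrightarrow> G \<in> L2_circle \<Longrightarrow> H \<in> L2_circle \<Longrightarrow>
    L2_inner (\<lambda>\<zeta>. F \<zeta> + G \<zeta>) H = L2_inner F H + L2_inner G H"
  by (simp add: L2_inner_def distrib_right integrable_L2_mult)

lemma L2_inner_scale_left: "L2_inner (\<lambda>\<zeta>. c * F \<zeta>) H = c * L2_inner F H"
  by (simp add: L2_inner_def mult.assoc)

lemma L2_inner_commute: "L2_inner G F = cnj (L2_inner F G)"
  by (simp add: L2_inner_def Bochner_Integration.integral_cnj[symmetric] mult.commute)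

lemma L2_circle_sum:
  "(\<And>i. i \<in> I \<Longrightarrow> F i \<in> L2_circle) \<Longrightarrow> (\<lambda>\<zeta>. \<Sum>i\<in>I. F i \<zeta>) \<in> L2_circle"
  by (induction I rule: infinite_finite_induct) (auto intro: L2_circle_add L2_circle_const)

lemma L2_inner_sum_left:
  assumes "\<And>i. i \<in> I \<Longrightarrow> F i \<in> L2_circle" "H \<in> L2_circle"
  shows "L2_inner (\<lambda>\<zeta>. \<Sum>i\<in>I. F i \<zeta>) H = (\<Sum>i\<in>I. L2_inner (F i) H)"
  using assms by (simp add: L2_inner_def sum_distrib_right integrable_L2_mult)

lemma L2_inner_cong_AE:
  assumes "F \<in> L2_circle" "F' \<in> L2_circle" "G \<in> L2_circle" "G' \<in> L2_circle"
    and "AE \<zeta> in circle_measure. F \<zeta> = F' \<zeta>" "AE \<zeta> in circle_measure. G \<zeta> = G' \<zeta>"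
  shows "L2_inner F G = L2_inner F' G'"
  unfolding L2_inner_def
proof (rule integral_cong_AE)
  show "AE \<zeta> in circle_measure. F \<zeta> * cnj (G \<zeta>) = F' \<zeta> * cnj (G' \<zeta>)"
    using assms(5,6) by eventually_elim simp
qed (use integrable_L2_mult assms in \<open>auto intro!: borel_measurable_integrable\<close>)

lemma L2_inner_self_eq_0:
  assumes "F \<in> L2_circle" "L2_inner F F = 0"
  shows "AE \<zeta> in circle_measure. F \<zeta> = 0"
proof -
  have "L2_inner F F = of_real (LINT \<zeta>|circle_measure. (norm (F \<zeta>))\<^sup>2)"
    by (simp add: L2_inner_def complex_norm_square[symmetric] flip: integral_complex_of_real)
  with assms have "(LINT \<zeta>|circle_measure. (norm (F \<zeta>))\<^sup>2) = 0" by simp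
  then have "AE \<zeta> in circle_measure. (norm (F \<zeta>))\<^sup>2 = 0"
    using assms by (subst (asm) integral_nonneg_eq_0_iff_AE) (auto simp: L2_circle_def)
  then show ?thesis by simp
qed

section \<open>The Hardy space\<close>

lemma hardy_disc_D:
  assumes "f \<in> hardy_disc"
  shows "f holomorphic_on ball 0 1"
    and "0 \<le> r \<Longrightarrow> r < 1 \<Longrightarrow> integrable circle_measure (\<lambda>\<zeta>. (norm (f (of_real r * \<zeta>)))\<^sup>2)"
    and "0 \<le> r \<Longrightarrow> r < 1 \<Longrightarrow> (\<lambda>\<zeta>. f (of_real r * \<zeta>)) \<in> borel_measurable circle_measure"
    and "\<exists>B. \<forall>r. 0 \<le> r \<longrightarrow> r < 1 \<longrightarrow> (LINT \<zeta>|circle_measure. (norm (f (of_real r * \<zeta>)))\<^sup>2) \<le> B"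
proof -
  show hol: "f holomorphic_on ball 0 1" using assms by (simp add: hardy_disc_def)
  have cont: "continuous_on (sphere 0 1) (\<lambda>\<zeta>. f (of_real r * \<zeta>))" if "0 \<le> r" "r < 1" for r :: real
    using that by (intro continuous_on_compose2[OF holomorphic_on_imp_continuous_on[OF hol]]
        continuous_intros) (auto simp: norm_mult)
  show "0 \<le> r \<Longrightarrow> r < 1 \<Longrightarrow> integrable circle_measure (\<lambda>\<zeta>. (norm (f (of_real r * \<zeta>)))\<^sup>2)"
    by (intro integrable_circle_continuous continuous_intros cont)
  show "0 \<le> r \<Longrightarrow> r < 1 \<Longrightarrow> (\<lambda>\<zeta>. f (of_real r * \<zeta>)) \<in> borel_measurable circle_measure"
    by (intro continuous_on_imp_measurable_circle cont)
  show "\<exists>B. \<forall>r. 0 \<le> r \<longrightarrow> r < 1 \<longrightarrow> (LINT \<zeta>|circle_measure. (norm (f (of_real r * \<zeta>)))\<^sup>2) \<le> B"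
    using assms by (force simp: hardy_disc_def bdd_above_def)
qed

lemma hardy_disc_I:
  assumes "f holomorphic_on ball 0 1"
    and "\<And>r. 0 \<le> r \<Longrightarrow> r < 1 \<Longrightarrow> (LINT \<zeta>|circle_measure. (norm (f (of_real r * \<zeta>)))\<^sup>2) \<le> B"
  shows "f \<in> hardy_disc"
  using assms by (force simp: hardy_disc_def bdd_above_def)

lemma circle_integral_le_const:
  assumes "continuous_on (sphere 0 1) g" "\<And>\<zeta>. norm \<zeta> = 1 \<Longrightarrow> g \<zeta> \<le> K"
  shows "(LINT \<zeta>|circle_measure. g \<zeta>) \<le> K * measure circle_measure (sphere 0 1)"
proof -
  have "(LINT \<zeta>|circle_measure. g \<zeta>) \<le> (LINT \<zeta>|circle_measure. K)"
    by (rule integral_mono) (use assms integrable_circle_continuous in \<open>auto simp: space_circle_measure\<close>)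
  then show ?thesis by (simp add: space_circle_measure mult.commute)
qed

lemma hardy_disc_mult_bounded:
  assumes f: "f \<in> hardy_disc" and b: "b holomorphic_on ball 0 1" "\<And>z. norm z < 1 \<Longrightarrow> norm (b z) \<le> K"
  shows "(\<lambda>z. b z * f z) \<in> hardy_disc"
proof -
  obtain B where B: "\<And>r. 0 \<le> r \<Longrightarrow> r < 1 \<Longrightarrow> (LINT \<zeta>|circle_measure. (norm (f (of_real r * \<zeta>)))\<^sup>2) \<le> B"
    using hardy_disc_D(4)[OF f] by blast
  have hol: "(\<lambda>z. b z * f z) holomorphic_on ball 0 1"
    by (intro holomorphic_intros b hardy_disc_D[OF f])
  show ?thesis
  proof (rule hardy_disc_I[OF hol, of "K\<^sup>2 * B"])
    fix r :: real assume r: "0 \<le> r" "r < 1"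
    have nr: "norm (of_real r * \<zeta>) < 1" if "norm \<zeta> = 1" for \<zeta> :: complex
      using that r by (simp add: norm_mult)
    have "(LINT \<zeta>|circle_measure. (norm (b (of_real r * \<zeta>) * f (of_real r * \<zeta>)))\<^sup>2) \<le>
        (LINT \<zeta>|circle_measure. K\<^sup>2 * (norm (f (of_real r * \<zeta>)))\<^sup>2)"
    proof (rule integral_mono)
      show "integrable circle_measure (\<lambda>\<zeta>. (norm (b (of_real r * \<zeta>) * f (of_real r * \<zeta>)))\<^sup>2)"
        using nr by (intro integrable_circle_continuous continuous_intros
            continuous_on_compose2[OF holomorphic_on_imp_continuous_on[OF b(1)]]
            continuous_on_compose2[OF holomorphic_on_imp_continuous_on[OF hardy_disc_D(1)[OF f]]]) auto
      show "integrable circle_measure (\<lambda>\<zeta>. K\<^sup>2 * (norm (f (of_real r * \<zeta>)))\<^sup>2)"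
        using hardy_disc_D(2)[OF f r] by simp
      fix \<zeta> assume "\<zeta> \<in> space circle_measure"
      then have "norm (b (of_real r * \<zeta>)) \<le> K" using b(2) nr by (simp add: space_circle_measure)
      then show "(norm (b (of_real r * \<zeta>) * f (of_real r * \<zeta>)))\<^sup>2 \<le> K\<^sup>2 * (norm (f (of_real r * \<zeta>)))\<^sup>2"
        by (auto simp: norm_mult power_mult_distrib intro!: mult_right_mono power_mono)
    qed
    also have "\<dots> \<le> K\<^sup>2 * B" using B[OF r] by (simp add: mult_left_mono)
    finally show "(LINT \<zeta>|circle_measure. (norm (b (of_real r * \<zeta>) * f (of_real r * \<zeta>)))\<^sup>2) \<le> K\<^sup>2 * B" .
  qed
qed

lemma hardy_disc_add:
  assumes f: "f \<in> hardy_disc" and g: "g \<in> hardy_disc"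
  shows "(\<lambda>z. f z + g z) \<in> hardy_disc"
proof -
  obtain B C where B: "\<And>r. 0 \<le> r \<Longrightarrow> r < 1 \<Longrightarrow> (LINT \<zeta>|circle_measure. (norm (f (of_real r * \<zeta>)))\<^sup>2) \<le> B"
    and C: "\<And>r. 0 \<le> r \<Longrightarrow> r < 1 \<Longrightarrow> (LINT \<zeta>|circle_measure. (norm (g (of_real r * \<zeta>)))\<^sup>2) \<le> C"
    using hardy_disc_D(4)[OF f] hardy_disc_D(4)[OF g] by blast
  have hol: "(\<lambda>z. f z + g z) holomorphic_on ball 0 1"
    by (intro holomorphic_intros hardy_disc_D[OF f] hardy_disc_D[OF g])
  show ?thesis
  proof (rule hardy_disc_I[OF hol, of "2 * B + 2 * C"])
    fix r :: real assume r: "0 \<le> r" "r < 1"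
    note [measurable] = hardy_disc_D(3)[OF f r] hardy_disc_D(3)[OF g r]
    have int: "integrable circle_measure
        (\<lambda>\<zeta>. 2 * (norm (f (of_real r * \<zeta>)))\<^sup>2 + 2 * (norm (g (of_real r * \<zeta>)))\<^sup>2)"
      using hardy_disc_D(2)[OF f r] hardy_disc_D(2)[OF g r] by simp
    have int': "integrable circle_measure (\<lambda>\<zeta>. (norm (f (of_real r * \<zeta>) + g (of_real r * \<zeta>)))\<^sup>2)"
      by (rule Bochner_Integration.integrable_bound[OF int]) (use norm_add_squared_le in auto)
    have "(LINT \<zeta>|circle_measure. (norm (f (of_real r * \<zeta>) + g (of_real r * \<zeta>)))\<^sup>2) \<le>
        (LINT \<zeta>|circle_measure. 2 * (norm (f (of_real r * \<zeta>)))\<^sup>2 + 2 * (norm (g (of_real r * \<zeta>)))\<^sup>2)"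
      by (rule integral_mono[OF int' int norm_add_squared_le])
    also have "\<dots> = 2 * (LINT \<zeta>|circle_measure. (norm (f (of_real r * \<zeta>)))\<^sup>2) +
        2 * (LINT \<zeta>|circle_measure. (norm (g (of_real r * \<zeta>)))\<^sup>2)"
      using hardy_disc_D(2)[OF f r] hardy_disc_D(2)[OF g r] by simp
    also have "\<dots> \<le> 2 * B + 2 * C" using B[OF r] C[OF r] by simp
    finally show "(LINT \<zeta>|circle_measure. (norm (f (of_real r * \<zeta>) + g (of_real r * \<zeta>)))\<^sup>2) \<le> 2 * B + 2 * C" .
  qed
qed

lemma hardy_disc_bounded:
  assumes "b holomorphic_on ball 0 1" "\<And>z. norm z < 1 \<Longrightarrow> norm (b z) \<le> K"
  shows "b \<in> hardy_disc"
proof -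
  have "(\<lambda>_. 1) \<in> hardy_disc"
    by (rule hardy_disc_I[of _ "measure circle_measure (sphere 0 1)"])
       (auto simp: space_circle_measure)
  from hardy_disc_mult_bounded[OF this assms] show ?thesis by simp
qed

text \<open>
The limit of Cauchy's formula on circles of radius \<open>r\<^sub>k\<close> increasing to \<open>1\<close>: the integrands are bounded in \<open>L\<^sup>2\<close> because the Cauchy kernel stays bounded near the unit circle, and they
converge almost everywhere because the radial limits exist, so the integrals converge.
\<close>

lemma hardy_reproducing:
  assumes f: "f \<in> hardy_disc" and bd: "radial_boundary f F" and F: "F \<in> L2_circle" and w: "norm w < 1"
  shows "(LINT \<zeta>|circle_measure. F \<zeta> * (\<zeta> / (\<zeta> - w))) = f w"
proof -
  obtain B where B: "\<And>r. 0 \<le> r \<Longrightarrow> r < 1 \<Longrightarrow> (LINT \<zeta>|circle_measure. (norm (f (of_real r * \<zeta>)))\<^sup>2) \<le> B"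
    using hardy_disc_D(4)[OF f] by blast
  \<comment> \<open>The radii stay at distance at least \<open>d\<close> from \<open>norm w\<close>, which bounds the kernel by \<open>1 / d\<close>.\<close>
  define d where "d = (1 - norm w) / 2"
  define r where "r = (\<lambda>k::nat. 1 - d / (real k + 1))"
  have d: "d > 0" using w by (simp add: d_def)
  have dk: "d / (real k + 1) > 0" "d / (real k + 1) \<le> d" for k
    using d by (auto simp: field_simps)
  have r1: "r k < 1" "norm w + d \<le> r k" for k
    using dk[of k] unfolding r_def d_def by (auto simp: field_simps)
  have r0: "0 < r k" "norm w < r k" for k
    using r1(2)[of k] d norm_ge_zero[of w] by linarith+
  have rlim: "r \<longlonglongrightarrow> 1"
    unfolding r_def by real_asymp
  define g where "g = (\<lambda>k \<zeta>. f (of_real (r k) * \<zeta>) * (of_real (r k) * \<zeta> / (of_real (r k) * \<zeta> - w)))"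
  have lower: "d \<le> norm (of_real (r k) * \<zeta> - w)" if "norm \<zeta> = 1" for k \<zeta>
    using norm_triangle_ineq2[of "of_real (r k) * \<zeta>" w] r1[of k] r0[of k] that by (simp add: norm_mult)
  have cont: "continuous_on (sphere 0 1) (g k)" for k
  proof -
    have "of_real (r k) * \<zeta> - w \<noteq> 0" if "norm \<zeta> = 1" for \<zeta>
      using lower[OF that, of k] d by auto
    then show ?thesis
      unfolding g_def using r0[of k] r1(1)[of k]
      by (intro continuous_intros continuous_on_compose2[OF holomorphic_on_imp_continuous_on[OF hardy_disc_D(1)[OF f]]])
         (auto simp: norm_mult)
  qed
  have gle: "(norm (g k \<zeta>))\<^sup>2 \<le> (norm (f (of_real (r k) * \<zeta>)))\<^sup>2 / d\<^sup>2" if "norm \<zeta> = 1" for k \<zeta>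
  proof -
    have "norm (of_real (r k) * \<zeta>) / norm (of_real (r k) * \<zeta> - w) \<le> 1 / d"
      using lower[OF that, of k] d that r0[of k] r1(1)[of k] by (intro frac_le) (auto simp: norm_mult)
    then have "norm (g k \<zeta>) \<le> norm (f (of_real (r k) * \<zeta>)) * (1 / d)"
      unfolding g_def by (simp only: norm_mult norm_divide) (rule mult_left_mono, auto)
    then have "(norm (g k \<zeta>))\<^sup>2 \<le> (norm (f (of_real (r k) * \<zeta>)) * (1 / d))\<^sup>2"
      by (rule power_mono) auto
    then show ?thesis by (simp add: power_divide)
  qed
  have ne: "\<zeta> - w \<noteq> 0" if "norm \<zeta> = 1" for \<zeta> using that w by auto
  have kernel: "continuous_on (sphere 0 1) (\<lambda>\<zeta>. \<zeta> / (\<zeta> - w))"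
    using ne by (intro continuous_intros) auto
  have "(\<lambda>k. LINT \<zeta>|circle_measure. g k \<zeta>) \<longlonglongrightarrow> (LINT \<zeta>|circle_measure. F \<zeta> * (\<zeta> / (\<zeta> - w)))"
  proof (rule circle.L2_bounded_AE_tendsto_imp_integral_tendsto)
    show "g k \<in> borel_measurable circle_measure" for k
      by (rule continuous_on_imp_measurable_circle[OF cont])
    have L2: "(\<lambda>\<zeta>. F \<zeta> * (\<zeta> / (\<zeta> - w))) \<in> L2_circle"
      using L2_circle_mult_continuous[OF F kernel] by (simp add: mult.commute)
    then show "(\<lambda>\<zeta>. F \<zeta> * (\<zeta> / (\<zeta> - w))) \<in> borel_measurable circle_measure"
      "integrable circle_measure (\<lambda>\<zeta>. (norm (F \<zeta> * (\<zeta> / (\<zeta> - w))))\<^sup>2)"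
      by (auto simp: L2_circle_def)
    show int: "integrable circle_measure (\<lambda>\<zeta>. (norm (g k \<zeta>))\<^sup>2)" for k
      by (intro integrable_circle_continuous continuous_intros cont)
    show "(LINT \<zeta>|circle_measure. (norm (g k \<zeta>))\<^sup>2) \<le> B / d\<^sup>2" for k
    proof -
      have "(LINT \<zeta>|circle_measure. (norm (g k \<zeta>))\<^sup>2) \<le>
          (LINT \<zeta>|circle_measure. (norm (f (of_real (r k) * \<zeta>)))\<^sup>2 / d\<^sup>2)"
        using hardy_disc_D(2)[OF f, of "r k"] r0[of k] r1(1)[of k] gle[of _ k]
        by (intro integral_mono int) (auto simp: space_circle_measure)
      also have "\<dots> \<le> B / d\<^sup>2" using B[of "r k"] r0[of k] r1(1)[of k] by (simp add: divide_right_mono)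
      finally show ?thesis .
    qed
    have rl: "filterlim r (at_left 1) sequentially"
      using rlim r1(1) by (auto simp: filterlim_at less_imp_neq intro!: always_eventually)
    show "AE \<zeta> in circle_measure. (\<lambda>k. g k \<zeta>) \<longlonglongrightarrow> F \<zeta> * (\<zeta> / (\<zeta> - w))"
      using bd[unfolded radial_boundary_def] AE_space
    proof eventually_elim
      case (elim \<zeta>)
      then have z: "norm \<zeta> = 1" by (simp add: space_circle_measure)
      have "(\<lambda>k. f (of_real (r k) * \<zeta>)) \<longlonglongrightarrow> F \<zeta>"
        using filterlim_compose[OF elim(1) rl] .
      then have "(\<lambda>k. g k \<zeta>) \<longlonglongrightarrow> F \<zeta> * (of_real 1 * \<zeta> / (of_real 1 * \<zeta> - w))"
        unfolding g_def using ne[OF z] by (intro tendsto_intros rlim) auto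
      then show ?case by simp
    qed
  qed
  moreover have "(LINT \<zeta>|circle_measure. g k \<zeta>) = f w" for k
    unfolding g_def by (rule Cauchy_formula_circle_measure[OF hardy_disc_D(1)[OF f] r0(1) r1(1) r0(2)])
  ultimately show ?thesis
    by (simp add: LIMSEQ_const_iff)
qed

text \<open>
By the reproducing formula a Hardy function is determined by its boundary function. Consequently
\<^const>\<open>disc_extension\<close> can be computed from any one extension that is known explicitly.
\<close>

lemma hardy_disc_eqI:
  assumes "f \<in> hardy_disc" "radial_boundary f F" "F \<in> L2_circle"
    and "g \<in> hardy_disc" "radial_boundary g G" "G \<in> L2_circle"
    and "AE \<zeta> in circle_measure. F \<zeta> = G \<zeta>" and w: "norm w < 1"
  shows "f w = g w"
proof -
  have kernel: "continuous_on (sphere 0 1) (\<lambda>\<zeta>. \<zeta> / (\<zeta> - w))"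
    using w by (intro continuous_intros) auto
  note [measurable] = continuous_on_imp_measurable_circle[OF kernel]
     assms(3,6)[THEN L2_circle_measurable]
  have "(LINT \<zeta>|circle_measure. F \<zeta> * (\<zeta> / (\<zeta> - w))) = (LINT \<zeta>|circle_measure. G \<zeta> * (\<zeta> / (\<zeta> - w)))"
  proof (rule integral_cong_AE)
    show "AE \<zeta> in circle_measure. F \<zeta> * (\<zeta> / (\<zeta> - w)) = G \<zeta> * (\<zeta> / (\<zeta> - w))"
      using assms(7) by eventually_elim simp
  qed measurable
  then show ?thesis using hardy_reproducing assms by metis
qed

definition disc_algebra :: "(complex \<Rightarrow> complex) set" where
  "disc_algebra = {b. b holomorphic_on ball 0 1 \<and> continuous_on (cball 0 1) b}"

lemma disc_algebra_bounded:
  assumes "b \<in> disc_algebra"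
  obtains K where "\<And>z. norm z \<le> 1 \<Longrightarrow> norm (b z) \<le> K"
proof -
  have "bounded (b ` cball 0 1)"
    using assms by (intro compact_imp_bounded compact_continuous_image) (auto simp: disc_algebra_def)
  then show ?thesis using that unfolding bounded_iff by (metis imageI mem_cball_0)
qed

lemma disc_algebra_radial_limit:
  assumes "b \<in> disc_algebra" "norm \<zeta> = 1"
  shows "((\<lambda>r::real. b (of_real r * \<zeta>)) \<longlongrightarrow> b \<zeta>) (at_left 1)"
proof -
  have "continuous_on {0..1} (\<lambda>r::real. b (of_real r * \<zeta>))"
    by (rule continuous_on_compose2[of "cball 0 1" b])
       (use assms in \<open>auto simp: disc_algebra_def norm_mult intro!: continuous_intros\<close>)
  then have "((\<lambda>r::real. b (of_real r * \<zeta>)) \<longlongrightarrow> b (of_real 1 * \<zeta>)) (at 1 within {0..1})"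
    unfolding continuous_on_def by (rule bspec) simp
  moreover have "at 1 within {0..1} = at_left (1::real)"
    by (simp add: at_within_Icc_at_left)
  ultimately show ?thesis by simp
qed

lemma disc_algebra_circle_continuous: "b \<in> disc_algebra \<Longrightarrow> continuous_on (sphere 0 1) b"
  unfolding disc_algebra_def by (auto intro: continuous_on_subset)

lemma H2_D: "F \<in> H2 \<Longrightarrow> F \<in> L2_circle" by (simp add: H2_def)

lemma hardy_disc_mult_disc_algebra:
  assumes f: "f \<in> hardy_disc" "radial_boundary f F" and b: "b \<in> disc_algebra"
  shows "(\<lambda>z. b z * f z) \<in> hardy_disc" "radial_boundary (\<lambda>z. b z * f z) (\<lambda>\<zeta>. b \<zeta> * F \<zeta>)"
proof -
  obtain K where K: "\<And>z. norm z \<le> 1 \<Longrightarrow> norm (b z) \<le> K"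
    using disc_algebra_bounded[OF b] by blast
  show "(\<lambda>z. b z * f z) \<in> hardy_disc"
    by (rule hardy_disc_mult_bounded[OF f(1), of _ K]) (use K b in \<open>auto simp: disc_algebra_def\<close>)
  show "radial_boundary (\<lambda>z. b z * f z) (\<lambda>\<zeta>. b \<zeta> * F \<zeta>)"
    using f(2) AE_space unfolding radial_boundary_def
    by eventually_elim
       (auto intro!: tendsto_mult disc_algebra_radial_limit b simp: space_circle_measure)
qed

lemma H2_mult:
  assumes "F \<in> H2" "b \<in> disc_algebra"
  shows "(\<lambda>\<zeta>. b \<zeta> * F \<zeta>) \<in> H2"
proof -
  from assms obtain f where f: "f \<in> hardy_disc" "radial_boundary f F" and F: "F \<in> L2_circle"
    by (auto simp: H2_def)
  show ?thesis
    using hardy_disc_mult_disc_algebra[OF f assms(2)]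
      L2_circle_mult_continuous[OF F disc_algebra_circle_continuous[OF assms(2)]]
    unfolding H2_def by blast
qed

text \<open>
The mean value property at the origin. Applied to suitable multipliers \<open>b\<close>, this is the only source of
orthogonality to \<open>H\<^sup>2\<close> functions in what follows.
\<close>

lemma H2_integral_mult_eq_0:
  assumes "F \<in> H2" "b \<in> disc_algebra" "b 0 = 0"
  shows "(LINT \<zeta>|circle_measure. b \<zeta> * F \<zeta>) = 0"
proof -
  from assms obtain f where f: "f \<in> hardy_disc" "radial_boundary f F" and F: "F \<in> L2_circle"
    by (auto simp: H2_def)
  have "(LINT \<zeta>|circle_measure. b \<zeta> * F \<zeta> * (\<zeta> / (\<zeta> - 0))) = b 0 * f 0"
    by (rule hardy_reproducing[OF hardy_disc_mult_disc_algebra[OF f assms(2)]])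
       (auto intro: L2_circle_mult_continuous[OF F disc_algebra_circle_continuous[OF assms(2)]])
  moreover have "(LINT \<zeta>|circle_measure. b \<zeta> * F \<zeta> * (\<zeta> / (\<zeta> - 0))) = (LINT \<zeta>|circle_measure. b \<zeta> * F \<zeta>)"
    by (rule Bochner_Integration.integral_cong) (auto simp: space_circle_measure)
  ultimately show ?thesis using assms(3) by simp
qed

lemma H2_const: "(\<lambda>_. c) \<in> H2"
proof -
  have "(\<lambda>_. c) \<in> hardy_disc" by (rule hardy_disc_bounded[of _ "norm c"]) auto
  then show ?thesis unfolding H2_def radial_boundary_def by (auto intro!: L2_circle_const bexI[of _ "\<lambda>_. c"])
qed

lemma disc_algebra_imp_H2: "b \<in> disc_algebra \<Longrightarrow> b \<in> H2"
  using H2_mult[OF H2_const[of 1]] by simp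

lemma H2_add:
  assumes "F \<in> H2" "G \<in> H2" shows "(\<lambda>\<zeta>. F \<zeta> + G \<zeta>) \<in> H2"
proof -
  from assms obtain f g where f: "f \<in> hardy_disc" "radial_boundary f F" and F: "F \<in> L2_circle"
    and g: "g \<in> hardy_disc" "radial_boundary g G" and G: "G \<in> L2_circle"
    by (auto simp: H2_def)
  have "radial_boundary (\<lambda>z. f z + g z) (\<lambda>\<zeta>. F \<zeta> + G \<zeta>)"
    using f(2) g(2) unfolding radial_boundary_def by eventually_elim (rule tendsto_add)
  then show ?thesis using hardy_disc_add[OF f(1) g(1)] L2_circle_add[OF F G] unfolding H2_def by blast
qed

text \<open>
The difference quotient of a Hardy function at a point \<open>a\<close> of the disc is again a Hardy function: on small circles
it is bounded because the singularity is removable, and on circles close to the boundary the denominator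
is bounded away from \<open>0\<close>.
\<close>

lemma H2_division:
  assumes F: "F \<in> H2" and a: "norm a < 1"
  obtains d G where "G \<in> H2" "\<And>\<zeta>. norm \<zeta> = 1 \<Longrightarrow> F \<zeta> = d + (\<zeta> - a) * G \<zeta>"
proof -
  from F obtain f0 where f0: "f0 \<in> hardy_disc" "radial_boundary f0 F" and FL: "F \<in> L2_circle"
    by (auto simp: H2_def)
  define d where "d = f0 a"
  define f where "f = (\<lambda>z. f0 z + (- d))"
  have "(\<lambda>_. - d) \<in> hardy_disc" by (rule hardy_disc_bounded[of _ "norm d"]) auto
  then have f: "f \<in> hardy_disc"
    unfolding f_def by (intro hardy_disc_add f0)
  have fa: "f a = 0" by (simp add: f_def d_def)
  obtain B where B: "\<And>r. 0 \<le> r \<Longrightarrow> r < 1 \<Longrightarrow> (LINT \<zeta>|circle_measure. (norm (f (of_real r * \<zeta>)))\<^sup>2) \<le> B"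
    using hardy_disc_D(4)[OF f] by blast
  define g where "g = (\<lambda>z. if z = a then deriv f a else (f z - f a) / (z - a))"
  have hol: "g holomorphic_on ball 0 1"
    unfolding g_def by (rule pole_lemma[OF hardy_disc_D(1)[OF f]]) (use a in auto)
  have geq: "g z = f z / (z - a)" if "z \<noteq> a" for z using that fa by (simp add: g_def)
  define R where "R = (1 + norm a) / 2"
  define e where "e = (1 - norm a) / 2"
  have R: "0 \<le> R" "R < 1" "norm a + e = R" "e > 0" using a norm_ge_zero[of a] 
    by (auto simp: R_def e_def field_simps add_nonneg_nonneg)
  have "bounded (g ` cball 0 R)"
    using R by (intro compact_imp_bounded compact_continuous_image
        holomorphic_on_imp_continuous_on[OF holomorphic_on_subset[OF hol]]) auto
  then obtain K where K: "\<And>z. norm z \<le> R \<Longrightarrow> norm (g z) \<le> K"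
    unfolding bounded_iff by (metis imageI mem_cball_0)
  have cont: "continuous_on (sphere 0 1) (\<lambda>\<zeta>. (norm (g (of_real r * \<zeta>)))\<^sup>2)" if "0 \<le> r" "r < 1" for r :: real
    using that by (intro continuous_on_compose2[OF holomorphic_on_imp_continuous_on[OF hol]]
        continuous_intros) (auto simp: norm_mult)
  have "g \<in> hardy_disc"
  proof (rule hardy_disc_I[OF hol, of "max (K\<^sup>2 * measure circle_measure (sphere 0 1)) (B / e\<^sup>2)"])
    fix r :: real assume r: "0 \<le> r" "r < 1"
    show "(LINT \<zeta>|circle_measure. (norm (g (of_real r * \<zeta>)))\<^sup>2) \<le>
       max (K\<^sup>2 * measure circle_measure (sphere 0 1)) (B / e\<^sup>2)"
    proof (cases "r \<le> R")
      case True
      have "(LINT \<zeta>|circle_measure. (norm (g (of_real r * \<zeta>)))\<^sup>2) \<le> K\<^sup>2 * measure circle_measure (sphere 0 1)"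
        using True r K by (intro circle_integral_le_const cont power_mono) (auto simp: norm_mult)
      then show ?thesis by simp
    next
      case False
      have "(LINT \<zeta>|circle_measure. (norm (g (of_real r * \<zeta>)))\<^sup>2) \<le>
          (LINT \<zeta>|circle_measure. (norm (f (of_real r * \<zeta>)))\<^sup>2 / e\<^sup>2)"
      proof (rule integral_mono)
        fix \<zeta> assume "\<zeta> \<in> space circle_measure"
        then have z: "norm \<zeta> = 1" by (simp add: space_circle_measure)
        have low: "e \<le> norm (of_real r * \<zeta> - a)"
          using norm_triangle_ineq2[of "of_real r * \<zeta>" a] r R False z by (simp add: norm_mult)
        then have "norm (g (of_real r * \<zeta>)) \<le> norm (f (of_real r * \<zeta>)) / e"
          using R by (subst geq) (auto simp: norm_divide intro!: divide_left_mono mult_pos_pos)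
        then have "(norm (g (of_real r * \<zeta>)))\<^sup>2 \<le> (norm (f (of_real r * \<zeta>)) / e)\<^sup>2"
          by (rule power_mono) auto
        then show "(norm (g (of_real r * \<zeta>)))\<^sup>2 \<le> (norm (f (of_real r * \<zeta>)))\<^sup>2 / e\<^sup>2"
          by (simp add: power_divide)
      qed (use hardy_disc_D(2)[OF f r] integrable_circle_continuous[OF cont[OF r]] in auto)
      also have "\<dots> \<le> B / e\<^sup>2" using B[OF r] by (simp add: divide_right_mono)
      finally show ?thesis by simp
    qed
  qed
  moreover have "radial_boundary g (\<lambda>\<zeta>. (1 / (\<zeta> - a)) * (F \<zeta> + (- d)))"
    using f0(2) AE_space unfolding radial_boundary_def
  proof eventually_elim
    case (elim \<zeta>)
    then have z: "norm \<zeta> = 1" by (simp add: space_circle_measure)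
    have "((\<lambda>r::real. (1 / (of_real r * \<zeta> - a)) * (f0 (of_real r * \<zeta>) + (- d))) \<longlongrightarrow>
        (1 / (of_real 1 * \<zeta> - a)) * (F \<zeta> + (- d))) (at_left 1)"
      using z a by (intro tendsto_intros elim(1)) auto
    moreover have "\<forall>\<^sub>F r in at_left 1. of_real r * \<zeta> \<noteq> a"
    proof -
      have "\<forall>\<^sub>F r::real in at_left 1. R < r"
        using R by (simp add: eventually_at_left_field) (metis dense)
      then show ?thesis 
      proof eventually_elim
        case (elim r)
        then have "norm (of_real r * \<zeta>) > norm a" using z R by (simp add: norm_mult)
        then show ?case by auto
      qed
    qed
    then have "\<forall>\<^sub>F r in at_left 1. g (of_real r * \<zeta>) = (1 / (of_real r * \<zeta> - a)) * (f0 (of_real r * \<zeta>) + (- d))"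
      by eventually_elim (simp add: geq f_def)
    ultimately show ?case by (simp add: tendsto_cong)
  qed
  moreover have "(\<lambda>\<zeta>. (1 / (\<zeta> - a)) * (F \<zeta> + (- d))) \<in> L2_circle"
    using a by (intro L2_circle_mult_continuous L2_circle_add FL L2_circle_const continuous_intros) auto
  ultimately have "(\<lambda>\<zeta>. (1 / (\<zeta> - a)) * (F \<zeta> + (- d))) \<in> H2" unfolding H2_def by blast
  moreover have "F \<zeta> = d + (\<zeta> - a) * ((1 / (\<zeta> - a)) * (F \<zeta> + (- d)))" if "norm \<zeta> = 1" for \<zeta>
    using that a by auto
  ultimately show ?thesis using that by blast
qed

text \<open>
Newton interpolation at the points of \<open>bs\<close>, obtained by dividing off one zero at a time. Repeated points give Hermite
interpolation, so that multiple zeros require no special treatment.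
\<close>

lemma H2_polynomial_division:
  assumes "F \<in> H2" "set bs \<subseteq> ball 0 1"
  shows "\<exists>p G. G \<in> H2 \<and> (\<forall>k\<ge>length bs. coeff p k = 0) \<and>
    (\<forall>\<zeta>. norm \<zeta> = 1 \<longrightarrow> F \<zeta> = poly p \<zeta> + (\<Prod>a\<leftarrow>bs. \<zeta> - a) * G \<zeta>)"
  using assms
proof (induction bs arbitrary: F)
  case Nil
  show ?case by (rule exI[of _ 0], rule exI[of _ F]) (simp add: Nil.prems)
next
  case (Cons a bs)
  from Cons.prems have "norm a < 1" by simp
  from H2_division[OF Cons.prems(1) this] obtain d G1
    where G1: "G1 \<in> H2" and F: "\<And>\<zeta>. norm \<zeta> = 1 \<Longrightarrow> F \<zeta> = d + (\<zeta> - a) * G1 \<zeta>" by blast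
  from Cons.IH[OF G1] Cons.prems obtain p G where G: "G \<in> H2" "\<And>k. k \<ge> length bs \<Longrightarrow> coeff p k = 0"
    and eq: "\<And>\<zeta>. norm \<zeta> = 1 \<Longrightarrow> G1 \<zeta> = poly p \<zeta> + (\<Prod>a\<leftarrow>bs. \<zeta> - a) * G \<zeta>" by auto
  show ?case
  proof (intro exI conjI allI impI)
    show "G \<in> H2" by fact
    show "coeff ([:d:] + [:-a, 1:] * p) k = 0" if "length (a # bs) \<le> k" for k
      using that G(2) by (cases k) (auto simp: coeff_pCons)
    show "F \<zeta> = poly ([:d:] + [:-a, 1:] * p) \<zeta> + (\<Prod>a\<leftarrow>a # bs. \<zeta> - a) * G \<zeta>" if "norm \<zeta> = 1" for \<zeta>
      by (simp add: F[OF that] eq[OF that] algebra_simps)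
  qed
qed

lemma disc_algebraI: "b holomorphic_on cball 0 1 \<Longrightarrow> b \<in> disc_algebra"
  unfolding disc_algebra_def
  using holomorphic_on_imp_continuous_on holomorphic_on_subset[OF _ ball_subset_cball] by blast

lemma holomorphic_poly: "poly p holomorphic_on A" for p :: "complex poly"
  using poly_holomorphic_on[OF holomorphic_on_ident] by simp

lemma integral_circle_powers: "(LINT \<zeta>|circle_measure. \<zeta> ^ i * cnj \<zeta> ^ j) = (if i = j then 1 else 0)"
proof -
  have pos: "(LINT \<zeta>|circle_measure. \<zeta> ^ i) = (if i = 0 then 1 else 0)" for i
  proof (cases "i = 0")
    case True
    have "(LINT \<zeta>|circle_measure. (1::complex) * (\<zeta> / (\<zeta> - 0))) = 1"
      by (rule hardy_reproducing[of "\<lambda>_. 1" "\<lambda>_. 1"])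
         (auto simp: radial_boundary_def intro!: hardy_disc_bounded[of _ 1] L2_circle_const)
    moreover have "(LINT \<zeta>|circle_measure. (1::complex) * (\<zeta> / (\<zeta> - 0))) = (LINT \<zeta>|circle_measure. 1)"
      by (rule Bochner_Integration.integral_cong) (auto simp: space_circle_measure)
    ultimately show ?thesis using True by simp
  next
    case False
    have "(\<lambda>z. z ^ i) \<in> disc_algebra" by (intro disc_algebraI holomorphic_intros)
    from H2_integral_mult_eq_0[OF H2_const[of 1] this] False show ?thesis by simp
  qed
  have up: "(LINT \<zeta>|circle_measure. \<zeta> ^ (j + k) * cnj \<zeta> ^ j) = (if k = 0 then 1 else 0)" for j k
  proof -
    have "(LINT \<zeta>|circle_measure. \<zeta> ^ (j + k) * cnj \<zeta> ^ j) = (LINT \<zeta>|circle_measure. \<zeta> ^ k)"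
    proof (rule Bochner_Integration.integral_cong)
      fix \<zeta> assume "\<zeta> \<in> space circle_measure"
      then have "\<zeta> * cnj \<zeta> = 1" by (simp add: space_circle_measure complex_norm_square[symmetric])
      then have "(\<zeta> * cnj \<zeta>) ^ j * \<zeta> ^ k = \<zeta> ^ k" by simp
      then show "\<zeta> ^ (j + k) * cnj \<zeta> ^ j = \<zeta> ^ k" by (simp add: power_add power_mult_distrib mult_ac)
    qed simp
    then show ?thesis by (simp add: pos)
  qed
  show ?thesis
  proof (cases "j \<le> i")
    case True
    then show ?thesis using up[of j "i - j"] by simp
  next
    case False
    have "(LINT \<zeta>|circle_measure. \<zeta> ^ i * cnj \<zeta> ^ j) = cnj (LINT \<zeta>|circle_measure. \<zeta> ^ j * cnj \<zeta> ^ i)"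
      by (simp add: mult.commute flip: Bochner_Integration.integral_cnj)
    also have "\<dots> = 0" using up[of i "j - i"] False by simp
    finally show ?thesis using False by simp
  qed
qed

text \<open>
Stolz regions of aperture \<open>\<alpha> > 1\<close> contain the end of the radius at \<open>\<zeta>\<close>; hence nontangential limits are unique.
\<close>

lemma stolz_region_nontrivial:
  assumes "norm \<zeta> = 1" "\<alpha> > 1"
  shows "at \<zeta> within stolz_region \<alpha> \<zeta> \<noteq> bot"
proof -
  have "\<zeta> islimpt stolz_region \<alpha> \<zeta>"
    unfolding islimpt_approachable
  proof (intro allI impI)
    fix e :: real assume e: "e > 0"
    define r where "r = max (1/2) (1 - e/2)"
    have r: "0 < r" "r < 1" "1 - r < e" using e by (auto simp: r_def)
    have "of_real r * \<zeta> - \<zeta> = of_real (r - 1) * \<zeta>" by (simp add: algebra_simps)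
    then have d: "norm (of_real r * \<zeta> - \<zeta>) = 1 - r"
      using assms r by (simp only: norm_mult norm_of_real) simp
    have "of_real r * \<zeta> \<in> stolz_region \<alpha> \<zeta>"
      using r assms d by (auto simp: stolz_region_def norm_mult)
    moreover have "of_real r * \<zeta> \<noteq> \<zeta>" using d r by auto
    ultimately show "\<exists>x'\<in>stolz_region \<alpha> \<zeta>. x' \<noteq> \<zeta> \<and> dist x' \<zeta> < e"
      using d r by (auto simp: dist_norm intro!: bexI[of _ "of_real r * \<zeta>"])
  qed
  then show ?thesis by (simp add: trivial_limit_within)
qed

section \<open>The model space of a finite Blaschke product\<close>

text \<open>
The polynomial \<open>z\<^sup>m\<close> times the conjugate of \<open>p\<close> at the reflected point \<open>1 / cnj z\<close>. It represents the canonical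
conjugation on the numerators of model space functions.
\<close>

definition reflect_conj :: "nat \<Rightarrow> complex poly \<Rightarrow> complex poly" where
  "reflect_conj m p = (\<Sum>k\<le>m. monom (cnj (coeff p (m - k))) k)"

lemma poly_reflect_conj_cnj:
  "cnj (poly (reflect_conj m p) z) = (\<Sum>k\<le>m. coeff p k * cnj z ^ (m - k))"
proof -
  have "cnj (poly (reflect_conj m p) z) = (\<Sum>k\<le>m. coeff p (m - k) * cnj z ^ k)"
    by (simp add: reflect_conj_def poly_sum poly_monom)
  also have "\<dots> = (\<Sum>k\<le>m. coeff p k * cnj z ^ (m - k))"
    by (rule sum.reindex_bij_witness[of _ "\<lambda>k. m - k" "\<lambda>k. m - k"]) auto
  finally show ?thesis .
qed

lemma poly_reflect_conj_circle:
  assumes "norm \<zeta> = 1" "degree p \<le> m"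
  shows "poly (reflect_conj m p) \<zeta> = \<zeta> ^ m * cnj (poly p \<zeta>)"
proof -
  have u: "\<zeta> * cnj \<zeta> = 1" using assms by (simp add: complex_norm_square[symmetric])
  have "cnj (poly (reflect_conj m p) \<zeta>) = (\<Sum>k\<le>m. coeff p k * cnj \<zeta> ^ (m - k))"
    by (rule poly_reflect_conj_cnj)
  also have "\<dots> = (\<Sum>k\<le>m. cnj \<zeta> ^ m * (coeff p k * \<zeta> ^ k))"
  proof (rule sum.cong)
    fix k assume "k \<in> {..m}"
    then have "cnj \<zeta> ^ m * \<zeta> ^ k = cnj \<zeta> ^ (m - k) * (\<zeta> * cnj \<zeta>) ^ k"
      by (simp add: power_mult_distrib mult_ac flip: power_add)
    with u show "coeff p k * cnj \<zeta> ^ (m - k) = cnj \<zeta> ^ m * (coeff p k * \<zeta> ^ k)"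
      by (simp add: mult_ac)
  qed simp
  also have "\<dots> = cnj \<zeta> ^ m * poly p \<zeta>"
    by (simp add: poly_eq_sum_le[OF assms(2)] sum_distrib_left)
  finally have "cnj (cnj (poly (reflect_conj m p) \<zeta>)) = cnj (cnj \<zeta> ^ m * poly p \<zeta>)" by simp
  then show ?thesis by simp
qed

lemma model_space_D:
  assumes "F \<in> model_space \<theta>"
  shows "F \<in> H2" "F \<in> L2_circle" "G \<in> H2 \<Longrightarrow> L2_inner F (\<lambda>\<zeta>. \<theta> \<zeta> * G \<zeta>) = 0"
  using assms by (auto simp: model_space_def H2_D)

text \<open>
A finite Blaschke product of order \<open>m + 1\<close>; polynomials of degree at most \<open>m\<close> will turn out to be the numerators of
the functions in its model space.
\<close>

locale blaschke_product =
  fixes \<theta> :: "complex \<Rightarrow> complex" and c :: complex and as :: "complex list" and m :: nat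
  assumes norm_c: "norm c = 1" and zeros: "set as \<subseteq> ball 0 1" and order: "length as = Suc m"
    and \<theta>_eq: "\<And>z. norm z \<le> 1 \<Longrightarrow> \<theta> z = c * (\<Prod>a\<leftarrow>as. (z - a) / (1 - cnj a * z))"
begin

definition num :: "complex \<Rightarrow> complex" where "num z = (\<Prod>a\<leftarrow>as. z - a)"
definition den :: "complex \<Rightarrow> complex" where "den z = (\<Prod>a\<leftarrow>as. 1 - cnj a * z)"
definition model_fun :: "complex poly \<Rightarrow> complex \<Rightarrow> complex" where "model_fun p z = poly p z / den z"

lemma c_unit: "c * cnj c = 1"
  using norm_c by (simp add: complex_norm_square[symmetric])

lemma \<theta>_quotient: "norm z \<le> 1 \<Longrightarrow> \<theta> z = c * num z / den z"
proof -
  have "(\<Prod>a\<leftarrow>bs. (z - a) / (1 - cnj a * z)) = (\<Prod>a\<leftarrow>bs. z - a) / (\<Prod>a\<leftarrow>bs. 1 - cnj a * z)" for bs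
    by (induction bs) auto
  then show "norm z \<le> 1 \<Longrightarrow> \<theta> z = c * num z / den z"
    by (simp add: \<theta>_eq num_def den_def)
qed

lemma den_nonzero: "norm z \<le> 1 \<Longrightarrow> den z \<noteq> 0"
proof -
  assume z: "norm z \<le> 1"
  have "1 - cnj a * z \<noteq> 0" if "a \<in> set as" for a
  proof
    assume "1 - cnj a * z = 0"
    then have "cnj a * z = 1" by (metis eq_iff_diff_eq_0)
    then have "norm (cnj a * z) = 1" by (metis norm_one)
    moreover have "norm a < 1" using that zeros by auto
    moreover have "norm a * norm z \<le> norm a * 1" using z by (intro mult_left_mono) auto
    ultimately show False by (simp add: norm_mult)
  qed
  then show "den z \<noteq> 0" by (auto simp: den_def prod_list_zero_iff)
qed

lemma num_circle: "norm \<zeta> = 1 \<Longrightarrow> num \<zeta> = \<zeta> ^ Suc m * cnj (den \<zeta>)"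
proof -
  assume "norm \<zeta> = 1"
  then have u: "\<zeta> * cnj \<zeta> = 1" by (simp add: complex_norm_square[symmetric])
  have "(\<Prod>a\<leftarrow>bs. \<zeta> - a) = \<zeta> ^ length bs * cnj (\<Prod>a\<leftarrow>bs. 1 - cnj a * \<zeta>)" for bs
  proof (induction bs)
    case (Cons a bs)
    have "\<zeta> - a = \<zeta> * (1 - a * cnj \<zeta>)" using u by (simp add: algebra_simps)
    then show ?case using Cons.IH by simp
  qed simp
  then show ?thesis by (simp add: num_def den_def order)
qed

lemma \<theta>_circle: "norm \<zeta> = 1 \<Longrightarrow> \<theta> \<zeta> = c * \<zeta> ^ Suc m * cnj (den \<zeta>) / den \<zeta>"
  by (simp add: \<theta>_quotient num_circle)

lemma \<theta>_unit: "norm \<zeta> = 1 \<Longrightarrow> \<theta> \<zeta> * cnj (\<theta> \<zeta>) = 1"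
proof -
  assume z: "norm \<zeta> = 1"
  then have "norm (\<theta> \<zeta>) = 1" using den_nonzero[of \<zeta>]
    by (simp add: \<theta>_circle norm_mult norm_divide norm_power norm_c)
  then show ?thesis by (simp add: complex_norm_square[symmetric])
qed

lemma holomorphic_den: "den holomorphic_on A"
proof -
  have "(\<lambda>z. \<Prod>a\<leftarrow>bs. 1 - cnj a * z) holomorphic_on A" for bs
    by (induction bs) (auto intro!: holomorphic_intros)
  then show ?thesis by (simp add: den_def[abs_def])
qed

lemma holomorphic_num: "num holomorphic_on A"
proof -
  have "(\<lambda>z. \<Prod>a\<leftarrow>bs. z - a) holomorphic_on A" for bs
    by (induction bs) (auto intro!: holomorphic_intros)
  then show ?thesis by (simp add: num_def[abs_def])
qed

lemma holomorphic_model_fun: "model_fun p holomorphic_on cball 0 1"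
  unfolding model_fun_def[abs_def] using den_nonzero
  by (intro holomorphic_on_divide holomorphic_poly holomorphic_den) auto

lemma model_fun_disc_algebra: "model_fun p \<in> disc_algebra"
  by (intro disc_algebraI holomorphic_model_fun)

lemma \<theta>_continuous: "continuous_on (sphere 0 1) \<theta>"
proof -
  have "(\<lambda>z. c * num z / den z) holomorphic_on cball 0 1"
    using den_nonzero
    by (intro holomorphic_on_divide holomorphic_on_mult holomorphic_on_const holomorphic_num holomorphic_den) auto
  then have "continuous_on (sphere 0 1) (\<lambda>z. c * num z / den z)"
    by (rule holomorphic_on_imp_continuous_on[OF holomorphic_on_subset]) auto
  then show ?thesis by (rule continuous_on_eq) (simp add: \<theta>_quotient)
qed

lemma \<theta>_mult_L2: "G \<in> L2_circle \<Longrightarrow> (\<lambda>\<zeta>. \<theta> \<zeta> * G \<zeta>) \<in> L2_circle"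
  by (rule L2_circle_mult_continuous[OF _ \<theta>_continuous])

lemma model_space_add:
  assumes "F \<in> model_space \<theta>" "G \<in> model_space \<theta>"
  shows "(\<lambda>\<zeta>. F \<zeta> + G \<zeta>) \<in> model_space \<theta>"
  using assms
  by (auto simp: model_space_def H2_add L2_inner_add_left H2_D \<theta>_mult_L2)

lemma model_space_scale:
  assumes "F \<in> model_space \<theta>"
  shows "(\<lambda>\<zeta>. a * F \<zeta>) \<in> model_space \<theta>"
proof -
  have "(\<lambda>_. a) \<in> disc_algebra" by (simp add: disc_algebra_def)
  then have "(\<lambda>\<zeta>. a * F \<zeta>) \<in> H2" using H2_mult model_space_D(1)[OF assms] by fastforce
  then show ?thesis using assms by (auto simp: model_space_def L2_inner_scale_left)
qed

lemma model_fun_smult: "model_fun (smult a p) \<zeta> = a * model_fun p \<zeta>"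
  by (simp add: model_fun_def)

lemma model_fun_sum: "model_fun (\<Sum>i\<in>I. p i) \<zeta> = (\<Sum>i\<in>I. model_fun (p i) \<zeta>)"
  by (simp add: model_fun_def poly_sum sum_divide_distrib)

text \<open>
On the circle, where the numerator of \<open>\<theta>\<close> is \<open>\<zeta>\<^sup>m\<^sup>+\<^sup>1\<close> times the conjugate of the denominator, the product below is the
conjugate of an analytic function vanishing at \<open>0\<close>. This gives both the orthogonality to \<open>\<theta> H\<^sup>2\<close> and the
action of the canonical conjugation.
\<close>

lemma model_fun_times_cnj_\<theta>:
  assumes z: "norm \<zeta> = 1" and deg: "degree p \<le> m"
  shows "model_fun p \<zeta> * cnj (\<theta> \<zeta>) = cnj (c * \<zeta> * model_fun (reflect_conj m p) \<zeta>)"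
proof -
  have "model_fun p \<zeta> * cnj (\<theta> \<zeta>) = cnj c * cnj \<zeta> * (cnj \<zeta> ^ m * poly p \<zeta>) / cnj (den \<zeta>)"
    using den_nonzero[of \<zeta>] z by (simp add: \<theta>_circle model_fun_def)
  also have "cnj \<zeta> ^ m * poly p \<zeta> = cnj (poly (reflect_conj m p) \<zeta>)"
    by (simp add: poly_reflect_conj_circle[OF z deg])
  finally show ?thesis by (simp add: model_fun_def)
qed

lemma model_conj_model_fun:
  assumes z: "norm \<zeta> = 1" and deg: "degree p \<le> m"
  shows "model_conj \<theta> (model_fun p) \<zeta> = model_fun (smult c (reflect_conj m p)) \<zeta>"
proof -
  have u: "\<zeta> * cnj \<zeta> = 1" using z by (simp add: complex_norm_square[symmetric])
  have "model_conj \<theta> (model_fun p) \<zeta> = cnj \<zeta> * cnj (model_fun p \<zeta> * cnj (\<theta> \<zeta>))"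
    by (simp add: model_conj_def mult_ac)
  also have "\<dots> = (\<zeta> * cnj \<zeta>) * (c * model_fun (reflect_conj m p) \<zeta>)"
    unfolding model_fun_times_cnj_\<theta>[OF z deg] by (simp add: mult_ac)
  finally show ?thesis using u by (simp add: model_fun_smult)
qed

lemma model_fun_model_space:
  assumes deg: "degree p \<le> m"
  shows "model_fun p \<in> model_space \<theta>"
proof -
  have "L2_inner (model_fun p) (\<lambda>\<zeta>. \<theta> \<zeta> * G \<zeta>) = 0" if G: "G \<in> H2" for G
  proof -
    define b where "b = (\<lambda>z. c * z * model_fun (reflect_conj m p) z)"
    have b: "b \<in> disc_algebra" unfolding b_def
      by (intro disc_algebraI holomorphic_intros holomorphic_model_fun)
    have "L2_inner (model_fun p) (\<lambda>\<zeta>. \<theta> \<zeta> * G \<zeta>) = (LINT \<zeta>|circle_measure. cnj (b \<zeta> * G \<zeta>))"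
      unfolding L2_inner_def
    proof (rule Bochner_Integration.integral_cong)
      fix \<zeta> assume "\<zeta> \<in> space circle_measure"
      then have z: "norm \<zeta> = 1" by (simp add: space_circle_measure)
      show "model_fun p \<zeta> * cnj (\<theta> \<zeta> * G \<zeta>) = cnj (b \<zeta> * G \<zeta>)"
        using model_fun_times_cnj_\<theta>[OF z deg] by (simp add: b_def flip: mult.assoc)
    qed simp
    also have "\<dots> = cnj (LINT \<zeta>|circle_measure. b \<zeta> * G \<zeta>)" by (rule Bochner_Integration.integral_cnj)
    also have "\<dots> = 0" using H2_integral_mult_eq_0[OF G b] by (simp add: b_def)
    finally show ?thesis .
  qed
  then show ?thesis using disc_algebra_imp_H2[OF model_fun_disc_algebra] by (simp add: model_space_def)
qed

text \<open>
Dividing \<open>den * F\<close> by the numerator of \<open>\<theta>\<close> writes \<open>F\<close> as a quotient \<open>p / den\<close> plus an element of \<open>\<theta> H\<^sup>2\<close>. The latter, as a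
difference of two functions in the model space, is orthogonal to \<open>\<theta> H\<^sup>2\<close>, hence to itself, and vanishes.
\<close>

lemma model_space_imp_model_fun:
  assumes F: "F \<in> model_space \<theta>"
  shows "\<exists>p. degree p \<le> m \<and> (AE \<zeta> in circle_measure. F \<zeta> = model_fun p \<zeta>)"
proof -
  have "den \<in> disc_algebra" by (intro disc_algebraI holomorphic_den)
  then have "(\<lambda>\<zeta>. den \<zeta> * F \<zeta>) \<in> H2" using H2_mult model_space_D(1)[OF F] by blast
  from H2_polynomial_division[OF this zeros] obtain p G where G: "G \<in> H2"
    and p: "\<And>k. k \<ge> Suc m \<Longrightarrow> coeff p k = 0"
    and eq: "\<And>\<zeta>. norm \<zeta> = 1 \<Longrightarrow> den \<zeta> * F \<zeta> = poly p \<zeta> + num \<zeta> * G \<zeta>"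
    by (auto simp: order num_def)
  have deg: "degree p \<le> m" using p by (intro degree_le) auto
  \<comment> \<open>The remainder: in the model space by linearity, and in \<open>\<theta> H\<^sup>2\<close> by the division.\<close>
  define E where "E = (\<lambda>\<zeta>. F \<zeta> + (- 1) * model_fun p \<zeta>)"
  have E: "E \<in> model_space \<theta>"
    unfolding E_def by (intro model_space_add model_space_scale F model_fun_model_space deg)
  have "(\<lambda>_. cnj c) \<in> disc_algebra" by (simp add: disc_algebra_def)
  then have G': "(\<lambda>\<zeta>. cnj c * G \<zeta>) \<in> H2" using H2_mult G by fastforce
  have E_eq: "E \<zeta> = \<theta> \<zeta> * (cnj c * G \<zeta>)" if "norm \<zeta> = 1" for \<zeta>
  proof -
    have "F \<zeta> = model_fun p \<zeta> + num \<zeta> * G \<zeta> / den \<zeta>"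
      using eq[OF that] den_nonzero[of \<zeta>] that by (simp add: model_fun_def field_simps)
    moreover have "\<theta> \<zeta> * (cnj c * G \<zeta>) = (c * cnj c) * (num \<zeta> * G \<zeta> / den \<zeta>)"
      using that by (simp add: \<theta>_quotient)
    ultimately show ?thesis using c_unit by (simp add: E_def)
  qed
  have "L2_inner E E = L2_inner E (\<lambda>\<zeta>. \<theta> \<zeta> * (cnj c * G \<zeta>))"
    unfolding L2_inner_def
    by (rule Bochner_Integration.integral_cong) (use E_eq in \<open>auto simp: space_circle_measure\<close>)
  also have "\<dots> = 0" by (rule model_space_D(3)[OF E G'])
  finally have "AE \<zeta> in circle_measure. E \<zeta> = 0"
    by (rule L2_inner_self_eq_0[OF model_space_D(2)[OF E]])
  then have "AE \<zeta> in circle_measure. F \<zeta> = model_fun p \<zeta>"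
    by eventually_elim (simp add: E_def)
  with deg show ?thesis by blast
qed

lemma model_fun_hardy: "model_fun p \<in> hardy_disc"
proof -
  obtain K where "\<And>z. norm z \<le> 1 \<Longrightarrow> norm (model_fun p z) \<le> K"
    using disc_algebra_bounded[OF model_fun_disc_algebra] by blast
  then show ?thesis
    using model_fun_disc_algebra by (intro hardy_disc_bounded[of _ K]) (auto simp: disc_algebra_def)
qed

lemma model_fun_radial_boundary:
  assumes "AE \<zeta> in circle_measure. F \<zeta> = model_fun p \<zeta>"
  shows "radial_boundary (model_fun p) F"
  unfolding radial_boundary_def using assms AE_space
  by eventually_elim (simp add: disc_algebra_radial_limit[OF model_fun_disc_algebra] space_circle_measure)

lemma model_fun_AE_eqD:
  assumes "AE \<zeta> in circle_measure. model_fun p \<zeta> = model_fun q \<zeta>"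
  shows "p = q"
proof -
  have L2: "model_fun r \<in> L2_circle" for r
    by (rule H2_D[OF disc_algebra_imp_H2[OF model_fun_disc_algebra]])
  have "model_fun p z = model_fun q z" if "norm z < 1" for z
    by (rule hardy_disc_eqI[OF model_fun_hardy model_fun_radial_boundary L2
          model_fun_hardy model_fun_radial_boundary L2 assms that]) simp_all
  then have "poly (p - q) z = 0" if "norm z < 1" for z
    using den_nonzero[of z] that by (fastforce simp: model_fun_def)
  then have "ball 0 1 \<subseteq> {z. poly (p - q) z = 0}" by auto
  moreover have "infinite (ball 0 1 :: complex set)"
    using uncountable_ball[of 1 "0::complex"] countable_finite by auto
  ultimately have "p - q = 0" using poly_roots_finite finite_subset by blast
  then show ?thesis by simp
qed

lemma disc_extension_model_fun:
  assumes "F \<in> L2_circle" "AE \<zeta> in circle_measure. F \<zeta> = model_fun p \<zeta>" "norm z < 1"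
  shows "disc_extension F z = model_fun p z"
proof -
  have "disc_extension F \<in> hardy_disc \<and> radial_boundary (disc_extension F) F"
    unfolding disc_extension_def by (rule someI[of _ "model_fun p"]) (use model_fun_hardy model_fun_radial_boundary[OF assms(2)] in auto)
  then show ?thesis
    by (intro hardy_disc_eqI[OF _ _ assms(1) model_fun_hardy model_fun_radial_boundary[OF assms(2)] assms(1) _ assms(3)]) auto
qed

text \<open>
The quotient \<open>p / den\<close> is continuous on the closed disc, so nontangential limits are just its values.
\<close>

lemma point_value_model_fun:
  assumes F: "F \<in> L2_circle" "AE \<zeta> in circle_measure. F \<zeta> = model_fun p \<zeta>" and z: "norm z \<le> 1"
  shows "point_value F z = model_fun p z"
proof (cases "norm z < 1")
  case True
  then show ?thesis using disc_extension_model_fun[OF F] by (simp add: point_value_def)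
next
  case False
  with z have z1: "norm z = 1" by simp
  have lim: "(disc_extension F \<longlongrightarrow> model_fun p z) (at z within stolz_region \<alpha> z)" for \<alpha>
  proof -
    have "(model_fun p \<longlongrightarrow> model_fun p z) (at z within cball 0 1)"
      using model_fun_disc_algebra z1 by (auto simp: disc_algebra_def continuous_on_def)
    then have "(model_fun p \<longlongrightarrow> model_fun p z) (at z within stolz_region \<alpha> z)"
      by (rule tendsto_within_subset) (auto simp: stolz_region_def)
    moreover have "\<forall>\<^sub>F x in at z within stolz_region \<alpha> z. disc_extension F x = model_fun p x"
      unfolding eventually_at_filter
      by (intro always_eventually allI impI disc_extension_model_fun[OF F]) (simp add: stolz_region_def)
    ultimately show ?thesis by (simp add: tendsto_cong)
  qed
  have "nontangential_lim (disc_extension F) z = model_fun p z"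
    unfolding nontangential_lim_def
  proof (rule the_equality)
    fix L assume "\<forall>\<alpha>>1. (disc_extension F \<longlongrightarrow> L) (at z within stolz_region \<alpha> z)"
    then have "(disc_extension F \<longlongrightarrow> L) (at z within stolz_region 2 z)" by simp
    then show "L = model_fun p z"
      using tendsto_unique[OF stolz_region_nontrivial[OF z1, of 2] _ lim] by simp
  qed (use lim in simp)
  then show ?thesis using False by (simp add: point_value_def)
qed

end

section \<open>Matrices of truncated Toeplitz operators\<close>

lemma model_orthonormal_basis_D:
  assumes "model_orthonormal_basis \<theta> v"
  shows "v j \<in> model_space \<theta>" "L2_inner (v i) (v j) = (if i = j then 1 else 0)"
    "F \<in> model_space \<theta> \<Longrightarrow> \<exists>a. AE \<zeta> in circle_measure. F \<zeta> = (\<Sum>j\<in>UNIV. a j * v j \<zeta>)"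
  using assms by (auto simp: model_orthonormal_basis_def)

lemma Linf_mult_L2:
  assumes "\<phi> \<in> Linf_circle" "F \<in> L2_circle"
  shows "(\<lambda>\<zeta>. \<phi> \<zeta> * F \<zeta>) \<in> L2_circle"
proof -
  from assms(1) obtain K where "\<phi> \<in> borel_measurable circle_measure" "AE \<zeta> in circle_measure. norm (\<phi> \<zeta>) \<le> K"
    by (auto simp: Linf_circle_def)
  then show ?thesis by (rule L2_circle_mult_bounded[OF assms(2)])
qed

lemma continuous_imp_Linf:
  assumes "continuous_on (sphere 0 1) b" shows "b \<in> Linf_circle"
proof -
  obtain K where "\<And>\<zeta>. norm \<zeta> = 1 \<Longrightarrow> norm (b \<zeta>) \<le> K"
    using continuous_on_circle_bounded[OF assms] by blast
  then show ?thesis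
    by (auto simp: Linf_circle_def intro!: continuous_on_imp_measurable_circle assms AE_circleI exI[of _ K])
qed

context blaschke_product
begin

lemma model_space_sum:
  assumes "\<And>i. i \<in> I \<Longrightarrow> F i \<in> model_space \<theta>"
  shows "(\<lambda>\<zeta>. \<Sum>i\<in>I. a i * F i \<zeta>) \<in> model_space \<theta>"
  using assms
proof (induction I rule: infinite_finite_induct)
  case (insert i I)
  then have "(\<lambda>\<zeta>. a i * F i \<zeta> + (\<Sum>i\<in>I. a i * F i \<zeta>)) \<in> model_space \<theta>"
    by (intro model_space_add model_space_scale) auto
  then show ?case using insert.hyps by simp
next
  case empty
  show ?case using model_fun_model_space[of 0] by (simp add: model_fun_def[abs_def])
next
  case (infinite I)
  then show ?case using model_fun_model_space[of 0] by (simp add: model_fun_def[abs_def])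
qed

text \<open>
The Fourier expansion along the orthonormal basis is an orthogonal projection, so that the choice made in
\<^const>\<open>model_proj\<close> is from a nonempty set. Inner products with model space functions do not depend on that choice.
\<close>

lemma model_proj_inner:
  fixes v :: "'n::finite \<Rightarrow> complex \<Rightarrow> complex"
  assumes v: "model_orthonormal_basis \<theta> v" and F: "F \<in> L2_circle"
  shows "model_proj \<theta> F \<in> model_space \<theta>"
    and "H \<in> model_space \<theta> \<Longrightarrow> L2_inner (model_proj \<theta> F) H = L2_inner F H"
proof -
  note basis = model_orthonormal_basis_D[OF v]
  define G where "G = (\<lambda>\<zeta>. \<Sum>j\<in>UNIV. L2_inner F (v j) * v j \<zeta>)"
  have G: "G \<in> model_space \<theta>"
    unfolding G_def by (intro model_space_sum basis)
  have diff: "L2_inner (\<lambda>\<zeta>. F \<zeta> - K \<zeta>) H = L2_inner F H - L2_inner K H"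
    if "K \<in> L2_circle" "H \<in> L2_circle" for K H
    using that F by (simp add: L2_inner_def left_diff_distrib integrable_L2_mult)
  have vL2: "v j \<in> L2_circle" for j by (rule model_space_D(2)[OF basis(1)])
  have avL2: "(\<lambda>\<zeta>. a * v j \<zeta>) \<in> L2_circle" for a j by (rule model_space_D(2)[OF model_space_scale[OF basis(1)]])
  have Gv: "L2_inner G (v i) = L2_inner F (v i)" for i
    unfolding G_def
    by (subst L2_inner_sum_left) (auto simp: avL2 vL2 L2_inner_scale_left basis(2) if_distrib[of "\<lambda>x. _ * x"] cong: if_cong)
  have perp_v: "L2_inner (\<lambda>\<zeta>. F \<zeta> - G \<zeta>) (v i) = 0" for i
    using diff[OF model_space_D(2)[OF G] vL2, of i] Gv[of i] by simp
  have FG: "(\<lambda>\<zeta>. F \<zeta> - G \<zeta>) \<in> L2_circle"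
    using L2_circle_add[OF F model_space_D(2)[OF model_space_scale[OF G, of "- 1"]]] by simp
  have perp: "L2_inner (\<lambda>\<zeta>. F \<zeta> - G \<zeta>) H = 0" if H: "H \<in> model_space \<theta>" for H
  proof -
    obtain a where a: "AE \<zeta> in circle_measure. H \<zeta> = (\<Sum>j\<in>UNIV. a j * v j \<zeta>)"
      using basis(3)[OF H] by blast
    have sumL2: "(\<lambda>\<zeta>. \<Sum>j\<in>UNIV. a j * v j \<zeta>) \<in> L2_circle"
      by (intro L2_circle_sum avL2)
    have "L2_inner H (\<lambda>\<zeta>. F \<zeta> - G \<zeta>) = L2_inner (\<lambda>\<zeta>. \<Sum>j\<in>UNIV. a j * v j \<zeta>) (\<lambda>\<zeta>. F \<zeta> - G \<zeta>)"
      by (rule L2_inner_cong_AE[OF model_space_D(2)[OF H] sumL2 FG FG a]) simp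
    also have "\<dots> = (\<Sum>j\<in>UNIV. a j * L2_inner (v j) (\<lambda>\<zeta>. F \<zeta> - G \<zeta>))"
      by (subst L2_inner_sum_left) (auto simp: avL2 FG L2_inner_scale_left)
    also have "\<dots> = 0"
      using perp_v by (simp add: L2_inner_commute[of "v _"])
    finally show ?thesis by (simp add: L2_inner_commute[of _ H])
  qed
  have proj: "model_proj \<theta> F \<in> model_space \<theta> \<and>
      (\<forall>H\<in>model_space \<theta>. L2_inner (\<lambda>\<zeta>. F \<zeta> - model_proj \<theta> F \<zeta>) H = 0)"
    unfolding model_proj_def by (rule someI[of _ G]) (use G perp in blast)
  then show mem: "model_proj \<theta> F \<in> model_space \<theta>" by blast
  show "L2_inner (model_proj \<theta> F) H = L2_inner F H" if "H \<in> model_space \<theta>"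
    using proj diff[OF model_space_D(2)[OF mem] model_space_D(2)[OF that]] that by simp
qed

text \<open>
Numerators are determined by the functions they represent, so relations holding almost everywhere on the circle become
polynomial identities: invariance under the conjugation turns into invariance under reflection, up to the factor \<open>c\<close>, and
spanning the model space into spanning the polynomials of degree at most \<open>m\<close>.
\<close>

lemma C_real_basis_polynomials:
  fixes v :: "'n::finite \<Rightarrow> complex \<Rightarrow> complex"
  assumes v: "C_real_basis \<theta> v"
  obtains p where "\<And>j. degree (p j) \<le> m" "\<And>j. AE \<zeta> in circle_measure. v j \<zeta> = model_fun (p j) \<zeta>"
    "\<And>j. smult c (reflect_conj m (p j)) = p j"
    "\<And>r. degree r \<le> m \<Longrightarrow> \<exists>a. r = (\<Sum>j\<in>UNIV. smult (a j) (p j))"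
proof -
  from v have basis: "model_orthonormal_basis \<theta> v"
    and real: "\<And>j. AE \<zeta> in circle_measure. model_conj \<theta> (v j) \<zeta> = v j \<zeta>"
    by (auto simp: C_real_basis_def)
  note basis = model_orthonormal_basis_D[OF basis]
  have "\<forall>j. \<exists>p. degree p \<le> m \<and> (AE \<zeta> in circle_measure. v j \<zeta> = model_fun p \<zeta>)"
    using model_space_imp_model_fun[OF basis(1)] by blast
  then obtain p where p: "\<And>j. degree (p j) \<le> m" "\<And>j. AE \<zeta> in circle_measure. v j \<zeta> = model_fun (p j) \<zeta>"
    by metis
  have "smult c (reflect_conj m (p j)) = p j" for j
  proof (rule model_fun_AE_eqD)
    show "AE \<zeta> in circle_measure. model_fun (smult c (reflect_conj m (p j))) \<zeta> = model_fun (p j) \<zeta>"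
      using real[of j] p(2)[of j] AE_space
    proof eventually_elim
      case (elim \<zeta>)
      then have "norm \<zeta> = 1" by (simp add: space_circle_measure)
      from model_conj_model_fun[OF this p(1)] elim show ?case by (simp add: model_conj_def)
    qed
  qed
  moreover have "\<exists>a. r = (\<Sum>j\<in>UNIV. smult (a j) (p j))" if r: "degree r \<le> m" for r
  proof -
    obtain a where "AE \<zeta> in circle_measure. model_fun r \<zeta> = (\<Sum>j\<in>UNIV. a j * v j \<zeta>)"
      using basis(3)[OF model_fun_model_space[OF r]] by blast
    moreover have "AE \<zeta> in circle_measure. \<forall>j\<in>UNIV. v j \<zeta> = model_fun (p j) \<zeta>"
      by (rule AE_finite_allI) (use p(2) in auto)
    ultimately have "AE \<zeta> in circle_measure. model_fun r \<zeta> = model_fun (\<Sum>j\<in>UNIV. smult (a j) (p j)) \<zeta>"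
      by eventually_elim (simp add: model_fun_sum model_fun_smult)
    then show ?thesis using model_fun_AE_eqD by blast
  qed
  ultimately show ?thesis using that p by blast
qed

text \<open>
Together with the next lemma: for a numerator of a real basis function, conjugated values are
multiples, by factors independent of the numerator, of homogeneous values of the same polynomial. A point \<open>\<zeta>\<close> of the
circle yields the projective point \<open>(\<zeta> : 1)\<close>, and a point \<open>z\<close> of the disc yields \<open>(1 : cnj z)\<close>.
\<close>

lemma cnj_poly_circle:
  assumes real: "smult c (reflect_conj m p) = p" and deg: "degree p \<le> m" and z: "norm \<zeta> = 1"
  shows "cnj (poly p \<zeta>) = cnj (c * \<zeta> ^ m) * poly p \<zeta>"
proof -
  have u: "\<zeta> * cnj \<zeta> = 1" using z by (simp add: complex_norm_square[symmetric])
  have "poly p \<zeta> = c * (\<zeta> ^ m * cnj (poly p \<zeta>))"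
    using arg_cong[OF real, of "\<lambda>q. poly q \<zeta>"] by (simp add: poly_reflect_conj_circle[OF z deg])
  then have "cnj (c * \<zeta> ^ m) * poly p \<zeta> = (c * cnj c) * (\<zeta> * cnj \<zeta>) ^ m * cnj (poly p \<zeta>)"
    by (simp add: power_mult_distrib mult_ac)
  then show ?thesis by (simp add: u c_unit)
qed

lemma cnj_poly_disc:
  assumes real: "smult c (reflect_conj m p) = p"
  shows "cnj (poly p z) = cnj c * hom_eval m p 1 (cnj z)"
proof -
  have "cnj (poly p z) = cnj c * cnj (poly (reflect_conj m p) z)"
    using arg_cong[OF real, of "\<lambda>q. cnj (poly q z)"] by simp
  then show ?thesis by (simp add: poly_reflect_conj_cnj hom_eval_def)
qed

text \<open>
On the circle, \<open>v\<^sub>i = \<theta> cnj (\<zeta> v\<^sub>i)\<close> turns \<open>v\<^sub>j cnj v\<^sub>i\<close> into \<open>cnj \<theta> * \<zeta> * v\<^sub>i * v\<^sub>j\<close>, which is a fixed weight times \<open>p\<^sub>i * p\<^sub>j\<close>.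
The matrix entry is therefore a linear functional, depending on the symbol only, evaluated at the polynomial \<open>p\<^sub>i * p\<^sub>j\<close>.
\<close>

lemma toeplitz_entry:
  fixes v :: "'n::finite \<Rightarrow> complex \<Rightarrow> complex"
  assumes \<phi>: "\<phi> \<in> Linf_circle"
    and vi: "v i \<in> L2_circle" "v j \<in> L2_circle"
    and deg: "\<And>j. degree (p j) \<le> m" and vp: "\<And>j. AE \<zeta> in circle_measure. v j \<zeta> = model_fun (p j) \<zeta>"
    and real: "\<And>j. smult c (reflect_conj m (p j)) = p j"
  shows "L2_inner (\<lambda>\<zeta>. \<phi> \<zeta> * v j \<zeta>) (v i) =
    (\<Sum>k\<le>2*m. coeff (p i * p j) k * (LINT \<zeta>|circle_measure. \<phi> \<zeta> * (cnj (\<theta> \<zeta>) * \<zeta> / (den \<zeta>)\<^sup>2 * \<zeta> ^ k)))"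
proof -
  define w where "w = (\<lambda>k \<zeta>. cnj (\<theta> \<zeta>) * \<zeta> / (den \<zeta>)\<^sup>2 * \<zeta> ^ k)"
  have den0: "den \<zeta> \<noteq> 0" if "norm \<zeta> = 1" for \<zeta> using den_nonzero that by simp
  have contden: "continuous_on (sphere 0 1) den"
    by (rule holomorphic_on_imp_continuous_on[OF holomorphic_den])
  have w: "continuous_on (sphere 0 1) (w k)" for k
    unfolding w_def using den0 by (intro continuous_intros \<theta>_continuous contden) auto
  have \<phi>L2: "\<phi> \<in> L2_circle"
    using Linf_mult_L2[OF \<phi> L2_circle_const[of 1]] by simp
  have int: "integrable circle_measure (\<lambda>\<zeta>. \<phi> \<zeta> * w k \<zeta>)" for k
    using integrable_L2[OF L2_circle_mult_continuous[OF \<phi>L2 w[of k]]] by (simp add: mult.commute)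
  have deg2: "degree (p i * p j) \<le> 2 * m"
    using degree_mult_le[of "p i" "p j"] deg[of i] deg[of j] by linarith
  have "L2_inner (\<lambda>\<zeta>. \<phi> \<zeta> * v j \<zeta>) (v i) =
      (LINT \<zeta>|circle_measure. (\<Sum>k\<le>2*m. coeff (p i * p j) k * (\<phi> \<zeta> * w k \<zeta>)))"
    unfolding L2_inner_def
  proof (rule integral_cong_AE)
    show "(\<lambda>\<zeta>. \<phi> \<zeta> * v j \<zeta> * cnj (v i \<zeta>)) \<in> borel_measurable circle_measure"
      by (rule borel_measurable_integrable[OF integrable_L2_mult[OF Linf_mult_L2[OF \<phi> vi(2)] vi(1)]])
    show "(\<lambda>\<zeta>. \<Sum>k\<le>2*m. coeff (p i * p j) k * (\<phi> \<zeta> * w k \<zeta>)) \<in> borel_measurable circle_measure"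
      by (intro borel_measurable_integrable Bochner_Integration.integrable_sum integrable_mult_right int)
    show "AE \<zeta> in circle_measure. \<phi> \<zeta> * v j \<zeta> * cnj (v i \<zeta>) = (\<Sum>k\<le>2*m. coeff (p i * p j) k * (\<phi> \<zeta> * w k \<zeta>))"
      using vp[of i] vp[of j] AE_space
    proof eventually_elim
      case (elim \<zeta>)
      then have z: "norm \<zeta> = 1" by (simp add: space_circle_measure)
      have "cnj (model_fun (p i) \<zeta>) = cnj (model_conj \<theta> (model_fun (p i)) \<zeta>)"
        using model_conj_model_fun[OF z deg[of i]] by (simp add: real)
      then have "cnj (v i \<zeta>) = cnj (\<theta> \<zeta>) * \<zeta> * model_fun (p i) \<zeta>"
        by (simp add: elim model_conj_def)
      then have "\<phi> \<zeta> * v j \<zeta> * cnj (v i \<zeta>) = \<phi> \<zeta> * (cnj (\<theta> \<zeta>) * \<zeta> / (den \<zeta>)\<^sup>2) * poly (p i * p j) \<zeta>"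
        by (simp add: elim model_fun_def power2_eq_square)
      also have "\<dots> = (\<Sum>k\<le>2*m. coeff (p i * p j) k * (\<phi> \<zeta> * w k \<zeta>))"
        unfolding poly_eq_sum_le[OF deg2] sum_distrib_left w_def by (rule sum.cong) (simp_all add: mult_ac)
      finally show ?case .
    qed
  qed
  also have "\<dots> = (\<Sum>k\<le>2*m. coeff (p i * p j) k * (LINT \<zeta>|circle_measure. \<phi> \<zeta> * w k \<zeta>))"
    using int by simp
  finally show ?thesis by (simp add: w_def)
qed

text \<open>
The weight has no zeros on the circle, so the symbol can cancel it; orthonormality of the powers of \<open>\<zeta>\<close> then allows any
moments \<open>l\<close>, hence any linear functional on the polynomials of degree at most \<open>2 m\<close>.
\<close>

lemma symbol_with_moments:
  obtains \<phi> where "\<phi> \<in> Linf_circle"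
    "\<And>k. k \<le> 2*m \<Longrightarrow> (LINT \<zeta>|circle_measure. \<phi> \<zeta> * (cnj (\<theta> \<zeta>) * \<zeta> / (den \<zeta>)\<^sup>2 * \<zeta> ^ k)) = l k"
proof
  define \<phi> where "\<phi> = (\<lambda>\<zeta>. \<theta> \<zeta> * (den \<zeta>)\<^sup>2 * cnj \<zeta> * (\<Sum>i\<le>2*m. l i * cnj \<zeta> ^ i))"
  have contden: "continuous_on (sphere 0 1) den"
    by (rule holomorphic_on_imp_continuous_on[OF holomorphic_den])
  show "\<phi> \<in> Linf_circle"
    unfolding \<phi>_def by (intro continuous_imp_Linf continuous_intros \<theta>_continuous contden)
  fix k assume k: "k \<le> 2*m"
  have "(LINT \<zeta>|circle_measure. \<phi> \<zeta> * (cnj (\<theta> \<zeta>) * \<zeta> / (den \<zeta>)\<^sup>2 * \<zeta> ^ k)) =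
      (LINT \<zeta>|circle_measure. (\<Sum>i\<le>2*m. l i * (\<zeta> ^ k * cnj \<zeta> ^ i)))"
  proof (rule Bochner_Integration.integral_cong)
    fix \<zeta> assume "\<zeta> \<in> space circle_measure"
    then have z: "norm \<zeta> = 1" by (simp add: space_circle_measure)
    have d: "(den \<zeta>)\<^sup>2 / (den \<zeta>)\<^sup>2 = 1" using den_nonzero[of \<zeta>] z by simp
    have u: "\<zeta> * cnj \<zeta> = 1" using z by (simp add: complex_norm_square[symmetric])
    have "\<phi> \<zeta> * (cnj (\<theta> \<zeta>) * \<zeta> / (den \<zeta>)\<^sup>2 * \<zeta> ^ k) =
      (\<theta> \<zeta> * cnj (\<theta> \<zeta>)) * ((den \<zeta>)\<^sup>2 / (den \<zeta>)\<^sup>2) * (\<zeta> * cnj \<zeta>) * ((\<Sum>i\<le>2*m. l i * cnj \<zeta> ^ i) * \<zeta> ^ k)"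
      by (simp add: \<phi>_def mult_ac)
    also have "\<dots> = (\<Sum>i\<le>2*m. l i * (\<zeta> ^ k * cnj \<zeta> ^ i))"
      unfolding d u \<theta>_unit[OF z] sum_distrib_right by (simp add: mult_ac)
    finally show "\<phi> \<zeta> * (cnj (\<theta> \<zeta>) * \<zeta> / (den \<zeta>)\<^sup>2 * \<zeta> ^ k) = (\<Sum>i\<le>2*m. l i * (\<zeta> ^ k * cnj \<zeta> ^ i))" .
  qed simp
  also have "\<dots> = (\<Sum>i\<le>2*m. l i * (LINT \<zeta>|circle_measure. \<zeta> ^ k * cnj \<zeta> ^ i))"
  proof -
    have "integrable circle_measure (\<lambda>\<zeta>. \<zeta> ^ k * cnj \<zeta> ^ i)" for i
      by (intro integrable_circle_continuous continuous_intros)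
    then show ?thesis by simp
  qed
  also have "\<dots> = l k"
    using k by (simp add: integral_circle_powers if_distrib[of "\<lambda>x. _ * x"] cong: if_cong)
  finally show "(LINT \<zeta>|circle_measure. \<phi> \<zeta> * (cnj (\<theta> \<zeta>) * \<zeta> / (den \<zeta>)\<^sup>2 * \<zeta> ^ k)) = l k" .
qed

text \<open>
A symbol enters the matrix of its operator only through a linear functional \<open>l\<close> on the polynomials of degree at most \<open>2 m\<close>, and every
such functional is available. Thus the operators disappear from the problem.
\<close>

lemma truncated_toeplitz_matrix_iff:
  fixes v :: "'n::finite \<Rightarrow> complex \<Rightarrow> complex"
  assumes v: "C_real_basis \<theta> v"
    and deg: "\<And>j. degree (p j) \<le> m" and vp: "\<And>j. AE \<zeta> in circle_measure. v j \<zeta> = model_fun (p j) \<zeta>"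
    and real: "\<And>j. smult c (reflect_conj m (p j)) = p j"
  shows "(\<exists>A. truncated_toeplitz \<theta> A \<and> basis_matrix v A = S) \<longleftrightarrow>
    (\<exists>l. \<forall>i j. S $ i $ j = (\<Sum>k\<le>2*m. coeff (p i * p j) k * l k))"
proof -
  from v have basis: "model_orthonormal_basis \<theta> v" by (simp add: C_real_basis_def)
  note vK = model_orthonormal_basis_D(1)[OF basis]
  note vL2 = model_space_D(2)[OF vK]
  note entry = toeplitz_entry[OF _ vL2 vL2 deg vp real]
  define mom where "mom = (\<lambda>\<phi> k. LINT \<zeta>|circle_measure. \<phi> \<zeta> * (cnj (\<theta> \<zeta>) * \<zeta> / (den \<zeta>)\<^sup>2 * \<zeta> ^ k))"
  have matrix: "basis_matrix v A $ i $ j = (\<Sum>k\<le>2*m. coeff (p i * p j) k * mom \<phi> k)"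
    if \<phi>: "\<phi> \<in> Linf_circle" and A: "\<And>F. F \<in> model_space \<theta> \<Longrightarrow> A F \<in> model_space \<theta> \<and>
     (AE \<zeta> in circle_measure. A F \<zeta> = model_proj \<theta> (\<lambda>\<xi>. \<phi> \<xi> * F \<xi>) \<zeta>)" for A \<phi> i j
  proof -
    note proj = model_proj_inner[OF basis Linf_mult_L2[OF \<phi> vL2[of j]]]
    have "basis_matrix v A $ i $ j = L2_inner (A (v j)) (v i)" by (simp add: basis_matrix_def)
    also have "\<dots> = L2_inner (model_proj \<theta> (\<lambda>\<xi>. \<phi> \<xi> * v j \<xi>)) (v i)"
      by (rule L2_inner_cong_AE) (use A[OF vK[of j]] model_space_D(2) proj(1) vL2 in auto)
    also have "\<dots> = L2_inner (\<lambda>\<xi>. \<phi> \<xi> * v j \<xi>) (v i)" by (rule proj(2)[OF vK])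
    also have "\<dots> = (\<Sum>k\<le>2*m. coeff (p i * p j) k * mom \<phi> k)"
      unfolding mom_def by (rule entry[OF \<phi>])
    finally show ?thesis .
  qed
  show ?thesis
  proof
    assume "\<exists>A. truncated_toeplitz \<theta> A \<and> basis_matrix v A = S"
    then show "\<exists>l. \<forall>i j. S $ i $ j = (\<Sum>k\<le>2*m. coeff (p i * p j) k * l k)"
      using matrix unfolding truncated_toeplitz_def by blast
  next
    assume "\<exists>l. \<forall>i j. S $ i $ j = (\<Sum>k\<le>2*m. coeff (p i * p j) k * l k)"
    then obtain l where l: "\<And>i j. S $ i $ j = (\<Sum>k\<le>2*m. coeff (p i * p j) k * l k)" by blast
    obtain \<phi> where \<phi>: "\<phi> \<in> Linf_circle" and mom: "\<And>k. k \<le> 2*m \<Longrightarrow> mom \<phi> k = l k"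
      using symbol_with_moments[of l] unfolding mom_def by blast
    define A where "A = (\<lambda>F. model_proj \<theta> (\<lambda>\<xi>. \<phi> \<xi> * F \<xi>))"
    have A: "A F \<in> model_space \<theta> \<and> (AE \<zeta> in circle_measure. A F \<zeta> = model_proj \<theta> (\<lambda>\<xi>. \<phi> \<xi> * F \<xi>) \<zeta>)"
      if "F \<in> model_space \<theta>" for F
      using model_proj_inner(1)[OF basis Linf_mult_L2[OF \<phi> model_space_D(2)[OF that]]] by (simp add: A_def)
    have "basis_matrix v A $ i $ j = S $ i $ j" for i j
    proof -
      have "basis_matrix v A $ i $ j = (\<Sum>k\<le>2*m. coeff (p i * p j) k * mom \<phi> k)"
        by (rule matrix[OF \<phi> A])
      also have "\<dots> = S $ i $ j"
        unfolding l by (rule sum.cong) (simp_all add: mom)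
      finally show ?thesis .
    qed
    then have "basis_matrix v A = S" by (simp add: vec_eq_iff)
    moreover have "truncated_toeplitz \<theta> A"
      unfolding truncated_toeplitz_def using \<phi> A by blast
    ultimately show "\<exists>A. truncated_toeplitz \<theta> A \<and> basis_matrix v A = S" by blast
  qed
qed

end

section \<open>The determinant condition for order three\<close>

lemma vector_6:
  "(vector [a, b, c, d, e, f] :: 'a::zero ^ 6) $ 1 = a"
  "(vector [a, b, c, d, e, f] :: 'a::zero ^ 6) $ 2 = b"
  "(vector [a, b, c, d, e, f] :: 'a::zero ^ 6) $ 3 = c"
  "(vector [a, b, c, d, e, f] :: 'a::zero ^ 6) $ 4 = d"
  "(vector [a, b, c, d, e, f] :: 'a::zero ^ 6) $ 5 = e"
  "(vector [a, b, c, d, e, f] :: 'a::zero ^ 6) $ 6 = f"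
  unfolding vector_def by simp_all

lemma exhaust_6: "x = 1 \<or> x = 2 \<or> x = 3 \<or> x = 4 \<or> x = 5 \<or> x = 6" for x :: 6
proof (induct x)
  case (of_int z)
  then have "z = 0 \<or> z = 1 \<or> z = 2 \<or> z = 3 \<or> z = 4 \<or> z = 5" by fastforce
  then show ?case by auto
qed

lemma forall_6: "(\<forall>i::6. P i) \<longleftrightarrow> P 1 \<and> P 2 \<and> P 3 \<and> P 4 \<and> P 5 \<and> P 6"
  by (metis exhaust_6)

text \<open>
The order of the entries is that of the columns in the theorem.
\<close>

definition pair_products :: "(3 \<Rightarrow> complex poly) \<Rightarrow> complex poly ^ 6" where
  "pair_products p = vector [p 1 * p 1, p 2 * p 2, p 3 * p 3, p 1 * p 2, p 1 * p 3, p 2 * p 3]"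

text \<open>
Every monomial of degree at most \<open>2 m\<close> is a product of two monomials of degree at most \<open>m\<close>, hence a combination of the
products \<open>p\<^sub>i * p\<^sub>j\<close>.
\<close>

lemma functional_vanishes_if_on_products:
  fixes p :: "'n::finite \<Rightarrow> complex poly"
  assumes span: "\<And>r. degree r \<le> m \<Longrightarrow> \<exists>a. r = (\<Sum>j\<in>UNIV. smult (a j) (p j))"
    and zero: "\<And>i j. (\<Sum>k\<le>2*m. coeff (p i * p j) k * l k) = 0"
    and "degree r \<le> 2*m"
  shows "(\<Sum>k\<le>2*m. coeff r k * l k) = 0"
proof -
  have "l k = 0" if k: "k \<le> 2*m" for k
  proof -
    obtain i where i: "i \<le> m" "k - i \<le> m" "i \<le> k" using k by (intro that[of "min k m"]) auto
    obtain a where a: "monom 1 i = (\<Sum>j\<in>UNIV. smult (a j) (p j))"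
      using span[of "monom 1 i"] i degree_monom_le[of 1 i] by (meson order_trans)
    obtain b where b: "monom 1 (k - i) = (\<Sum>j\<in>UNIV. smult (b j) (p j))"
      using span[of "monom 1 (k - i)"] i degree_monom_le[of 1 "k - i"] by (meson order_trans)
    have "monom 1 k = (monom 1 i * monom 1 (k - i) :: complex poly)"
      using i by (simp add: mult_monom)
    also have "\<dots> = (\<Sum>j\<in>UNIV. \<Sum>j'\<in>UNIV. smult (a j * b j') (p j * p j'))"
      unfolding a b by (simp add: sum_product mult.commute)
    finally have prod: "monom 1 k = (\<Sum>j\<in>UNIV. \<Sum>j'\<in>UNIV. smult (a j * b j') (p j * p j'))" .
    have "l k = (\<Sum>k'\<le>2*m. coeff (monom 1 k) k' * l k')"
      using k by (simp add: if_distrib[of "\<lambda>x. x * _"] cong: if_cong)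
    also have "\<dots> = (\<Sum>k'\<le>2*m. \<Sum>j\<in>UNIV. \<Sum>j'\<in>UNIV. a j * b j' * (coeff (p j * p j') k' * l k'))"
      unfolding prod by (simp add: coeff_sum sum_distrib_right mult.assoc)
    also have "\<dots> = (\<Sum>j\<in>UNIV. \<Sum>j'\<in>UNIV. a j * b j' * (\<Sum>k'\<le>2*m. coeff (p j * p j') k' * l k'))"
      unfolding sum_distrib_left by (subst sum.swap) (intro sum.cong refl sum.swap)
    also have "\<dots> = 0" by (simp add: zero)
    finally show ?thesis .
  qed
  then show ?thesis by (intro sum.neutral) auto
qed

theorem theorem3p2:
  fixes \<theta> :: "complex \<Rightarrow> complex"
    and v :: "3 \<Rightarrow> complex \<Rightarrow> complex"
    and t1 t2 t3 l4 l5 :: complex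
    and s1 s2 s3 s4 s5 s6 :: complex
  assumes "finite_blaschke 3 \<theta>"
    and "C_real_basis \<theta> v"
    and "{t1, t2, t3} \<subseteq> sphere 0 1" and "distinct [t1, t2, t3]"
    and "{l4, l5} \<subseteq> ball 0 1" and "l4 \<noteq> l5"
  shows "(\<exists>A. truncated_toeplitz \<theta> A \<and>
            basis_matrix v A = vector [vector [s1, s4, s5],
                                       vector [s4, s2, s6],
                                       vector [s5, s6, s3]])
         \<longleftrightarrow>
         det (transpose (vector
                [circle_column v t1, circle_column v t2, circle_column v t3,
                 disc_column v l4, disc_column v l5,
                 vector [s1, s2, s3, s4, s5, s6]])) = 0"
proof -
  from assms(1) obtain c as where c: "norm c = 1" and as: "length as = 3" "set as \<subseteq> ball 0 1"
    and \<theta>: "\<And>z. z \<in> cball 0 1 \<Longrightarrow> \<theta> z = c * (\<Prod>a\<leftarrow>as. (z - a) / (1 - cnj a * z))"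
    unfolding finite_blaschke_def by blast
  interpret blaschke_product \<theta> c as 2
  proof
    show "length as = Suc 2" using as by simp
    show "\<theta> z = c * (\<Prod>a\<leftarrow>as. (z - a) / (1 - cnj a * z))" if "norm z \<le> 1" for z
      using that by (intro \<theta>) simp
  qed (fact c as(2))+
  obtain p where deg: "\<And>j. degree (p j) \<le> 2"
    and vp: "\<And>j. AE \<zeta> in circle_measure. v j \<zeta> = model_fun (p j) \<zeta>"
    and real: "\<And>j. smult c (reflect_conj 2 (p j)) = p j"
    and span: "\<And>r. degree r \<le> 2 \<Longrightarrow> \<exists>a. r = (\<Sum>j\<in>UNIV. smult (a j) (p j))"
    by (rule C_real_basis_polynomials[OF assms(2)], rule that)
  define e where "e = (\<lambda>a. pair_products p $ a)"
  note e_simps = e_def pair_products_def vector_6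
  have vL2: "v j \<in> L2_circle" for j
    using model_space_D(2)[OF model_orthonormal_basis_D(1)] assms(2) unfolding C_real_basis_def by blast
  have pv: "point_value (v j) z = model_fun (p j) z" if "norm z \<le> 1" for j z
    by (rule point_value_model_fun[OF vL2 vp that])
  have hom: "hom_eval 4 (p i * p j) x y = hom_eval 2 (p i) x y * hom_eval 2 (p j) x y" for i j x y
    using hom_eval_mult[OF deg deg, of i j x y] by simp
  \<comment> \<open>Both kinds of columns are nonzero multiples of homogeneous evaluations of the products.\<close>
  define \<kappa>1 where "\<kappa>1 = (\<lambda>t. cnj (c * t\<^sup>2) / (den t * cnj (den t)))"
  define \<kappa>2 where "\<kappa>2 = (\<lambda>z. (cnj c / cnj (den z))\<^sup>2)"
  have circ: "circle_column v t $ a = \<kappa>1 t * hom_eval 4 (e a) t 1" if t: "norm t = 1" for t a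
  proof -
    have "model_fun (p i) t * cnj (model_fun (p j) t) = \<kappa>1 t * hom_eval 4 (p i * p j) t 1" for i j
      unfolding model_fun_def complex_cnj_divide cnj_poly_circle[OF real deg t] hom \<kappa>1_def
      using deg by (simp add: hom_eval_nonzero)
    then have "\<forall>a. circle_column v t $ a = \<kappa>1 t * hom_eval 4 (e a) t 1"
      unfolding forall_6 using t by (simp add: circle_column_def Let_def e_simps pv)
    then show ?thesis by blast
  qed
  have disc: "disc_column v z $ a = \<kappa>2 z * hom_eval 4 (e a) 1 (cnj z)" if z: "norm z < 1" for z a
  proof -
    have "cnj (model_fun (p i) z * model_fun (p j) z) = \<kappa>2 z * hom_eval 4 (p i * p j) 1 (cnj z)" for i j
      unfolding model_fun_def complex_cnj_divide complex_cnj_mult cnj_poly_disc[OF real] hom \<kappa>2_def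
      by (simp add: power2_eq_square)
    then have "\<forall>a. disc_column v z $ a = \<kappa>2 z * hom_eval 4 (e a) 1 (cnj z)"
      unfolding forall_6 using z by (simp add: disc_column_def Let_def e_simps pv)
    then show ?thesis by blast
  qed
  from assms(3,5) have t: "norm t1 = 1" "norm t2 = 1" "norm t3 = 1" and l: "norm l4 < 1" "norm l5 < 1"
    by auto
  define M :: "complex ^ 6 ^ 6" where "M = vector
      [circle_column v t1, circle_column v t2, circle_column v t3,
       disc_column v l4, disc_column v l5, vector [s1, s2, s3, s4, s5, s6]]"
  \<comment> \<open>Homogeneous coordinates and factors of the five points; the sixth entries are dummies.\<close>
  define x :: "6 \<Rightarrow> complex" where "x = ($) (vector [t1, t2, t3, 1, 1, 0])"
  define y :: "6 \<Rightarrow> complex" where "y = ($) (vector [1, 1, 1, cnj l4, cnj l5, 0])"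
  define \<kappa> :: "6 \<Rightarrow> complex" where "\<kappa> = ($) (vector [\<kappa>1 t1, \<kappa>1 t2, \<kappa>1 t3, \<kappa>2 l4, \<kappa>2 l5, 0])"
  have det: "det M = 0 \<longleftrightarrow> (\<exists>l. \<forall>a. M $ 6 $ a = (\<Sum>k\<le>4. coeff (e a) k * l k))"
  proof (rule det_hom_eval_rows_eq_0_iff)
    show "CARD(6) = 4 + 2" by simp
    have "degree (p i * p j) \<le> 4" for i j
      using degree_mult_le[of "p i" "p j"] deg[of i] deg[of j] by linarith
    then have "\<forall>a. degree (e a) \<le> 4" unfolding forall_6 by (simp add: e_simps)
    then show "degree (e a) \<le> 4" for a by blast
    show "(\<Sum>k\<le>4. coeff r k * l k) = 0"
      if zero: "\<And>a. (\<Sum>k\<le>4. coeff (e a) k * l k) = 0" and r: "degree r \<le> 4" for l r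
    proof -
      have "\<forall>i j. (\<Sum>k\<le>4. coeff (p i * p j) k * l k) = 0"
        using zero[of 1] zero[of 2] zero[of 3] zero[of 4] zero[of 5] zero[of 6]
        unfolding forall_3 e_simps by (simp add: mult.commute)
      then show ?thesis
        using functional_vanishes_if_on_products[of 2 p l r] span r by simp
    qed
    \<comment> \<open>A circle point and a disc point give different projective points.\<close>
    have tl: "t * cnj z \<noteq> 1" if "norm t = 1" "norm z < 1" for t z :: complex
      using that by (metis complex_mod_cnj less_irrefl mult_1 norm_mult norm_one)
    have "\<forall>i j. i \<noteq> 6 \<longrightarrow> j \<noteq> 6 \<longrightarrow> i \<noteq> j \<longrightarrow> x i * y j \<noteq> y i * x j"
      unfolding forall_6 x_def y_def vector_6
      using assms(4,6) tl t l by (auto simp: mult.commute)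
    then show "x i * y j \<noteq> y i * x j" if "i \<noteq> 6" "j \<noteq> 6" "i \<noteq> j" for i j
      using that by blast
    have "\<forall>i. i \<noteq> 6 \<longrightarrow> M $ i $ a = \<kappa> i * hom_eval 4 (e a) (x i) (y i)" for a
      unfolding forall_6 M_def x_def y_def \<kappa>_def vector_6
      using circ disc t l by simp
    then show "M $ i $ a = \<kappa> i * hom_eval 4 (e a) (x i) (y i)" if "i \<noteq> 6" for i a
      using that by blast
    have "c \<noteq> 0" using c by auto
    then have "\<forall>i. i \<noteq> 6 \<longrightarrow> \<kappa> i \<noteq> 0"
      unfolding forall_6 \<kappa>_def vector_6 \<kappa>1_def \<kappa>2_def
      using t l den_nonzero by auto
    then show "\<kappa> i \<noteq> 0" if "i \<noteq> 6" for i
      using that by blast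
  qed
  have "(\<exists>A. truncated_toeplitz \<theta> A \<and>
            basis_matrix v A = vector [vector [s1, s4, s5],
                                       vector [s4, s2, s6],
                                       vector [s5, s6, s3]]) \<longleftrightarrow>
     (\<exists>l. \<forall>i j. (vector [vector [s1, s4, s5], vector [s4, s2, s6], vector [s5, s6, s3]]
        :: complex ^ 3 ^ 3) $ i $ j = (\<Sum>k\<le>2*2. coeff (p i * p j) k * l k))"
    by (rule truncated_toeplitz_matrix_iff[OF assms(2) deg vp real])
  also have "\<dots> \<longleftrightarrow> (\<exists>l. \<forall>a. M $ 6 $ a = (\<Sum>k\<le>4. coeff (e a) k * l k))"
    unfolding forall_3 forall_6 M_def e_simps vector_3
    by (rule ex_cong1) (auto simp: mult.commute)
  also have "\<dots> \<longleftrightarrow> det (transpose M) = 0"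
    by (simp add: det det_transpose)
  finally show ?thesis unfolding M_def .
qed

end
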